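(* Let $\mathcal{A}$ be a finite central arrangement in an $\ell$-dimensional Euclidean space $V$ and $m:\mathcal{A}\to\mathbb{Z}$ a multiplicity. Then the generalized logarithmic module $D\Omega(\mathcal{A},m)$, formed with respect to a fixed inner product $I^*$ on $V^*$, is a reflexive $S$-module.
   Context: $V$ is an $\ell$-dimensional real vector space with a fixed inner product $I^*$ on $V^*$; $x_1,\dots,x_\ell$ is a basis of $V^*$; $S=\mathrm{Sym}(V^* )\otimes_{\mathbb{R}}\mathbb{C}\simeq\mathbb{C}[x_1,\dots,x_\ell]$, $\mathrm{Der}_{\mathbb{C}}(S)=\bigoplus_i S\,\partial_{x_i}$, $\Omega^1_V=\bigoplus_i S\,dx_i$; the subscript $(0)$ denotes localization at the ideal $(0)$ (coefficients in the fraction field of $S$). A central arrangement $\mathcal{A}$ is a finite set of linear hyperplanes in $V$; for each $H\in\mathcal{A}$ fix $\alpha_H\in V^*$ with $\ker\alpha_H=H$. For a finite set $\mathcal{B}$ of linear hyperplanes and $n:\mathcal{B}\to\mathbb{Z}_{\ge 0}$, put $Q(\mathcal{B},n)=\prod_{H\in\mathcal{B}}\alpha_H^{n(H)}$ and $$D(\mathcal{B},n)=\{\theta\in\mathrm{Der}_{\mathbb{C}}(S)\mid \theta(\alpha_H)\in S\alpha_H^{n(H)}\ \forall H\in\mathcal{B}\},$$ $$\Omega^1(\mathcal{B},n)=\{\omega\in \tfrac{1}{Q(\mathcal{B},n)}\Omega^1_V\mid d\alpha_H\wedge\omega \text{ is regular (has no pole) along } H\ \forall H\in\mathcal{B}\}.$$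 The inner product induces an $S$-linear isomorphism $I^*:\Omega^1_V\to\mathrm{Der}_{\mathbb{C}}(S)$, $I^*(\omega)(f)=I^*(\omega,df)$ (with $I^*$ extended $S$-bilinearly), and likewise $I^*:(\Omega^1_V)_{(0)}\to \mathrm{Der}_{\mathbb{C}}(S)_{(0)}$. For a multiplicity $m:\mathcal{A}\to\mathbb{Z}$ let $\mathcal{A}_+=\{H: m(H)>0\}$, $\mathcal{A}_-=\{H: m(H)<0\}$, $Q_+=\prod_{H\in\mathcal{A}_+}\alpha_H^{m(H)}$, $Q_-=\prod_{H\in\mathcal{A}_-}\alpha_H^{-m(H)}$, and for $\mu\in\{+,-\}$ let $m_\mu(H)=m(H)$ if $H\in\mathcal{A}_\mu$ and $m_\mu(H)=0$ otherwise. The generalized logarithmic module is the $S$-module $$D\Omega(\mathcal{A},m)=\tfrac{1}{Q_-}D(\mathcal{A}_+,m_+)\cap I^*(\Omega^1(\mathcal{A}_-,-m_-))\subset \mathrm{Der}_{\mathbb{C}}(S)_{(0)}.$$ *)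

theory Defs
  imports
    Complex_Main
    "HOL-Library.Poly_Mapping"
    "HOL-Library.FuncSet"
    "HOL-Computational_Algebra.Polynomial_Factorial"
    "HOL-Algebra.Module"
    "HOL-Algebra.Divisibility"
begin

section \<open>Reflexive modules\<close>

text \<open>\<open>Hom\<^sub>R(M, R)\<close>. Functionals are extensional, i.e. \<^const>\<open>undefined\<close> outside
  \<open>carrier M\<close>. The fields \<open>mult\<close> and \<open>one\<close>, which a module record inherits from the ring
  record, play no role.\<close>

definition dual_module ::
    "('a, 'c) ring_scheme \<Rightarrow> ('a, 'b, 'd) module_scheme \<Rightarrow> ('a, 'b \<Rightarrow> 'a) module"
  where "dual_module R M =
    \<lparr> carrier = {f \<in> carrier M \<rightarrow>\<^sub>E carrier R.
        (\<forall>u\<in>carrier M. \<forall>v\<in>carrier M. f (u \<oplus>\<^bsub>M\<^esub> v) = f u \<oplus>\<^bsub>R\<^esub> f v) \<and>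
        (\<forall>a\<in>carrier R. \<forall>u\<in>carrier M. f (a \<odot>\<^bsub>M\<^esub> u) = a \<otimes>\<^bsub>R\<^esub> f u)},
      mult = undefined, one = undefined,
      zero = (\<lambda>u\<in>carrier M. \<zero>\<^bsub>R\<^esub>),
      add = (\<lambda>f g. \<lambda>u\<in>carrier M. f u \<oplus>\<^bsub>R\<^esub> g u),
      smult = (\<lambda>a f. \<lambda>u\<in>carrier M. a \<otimes>\<^bsub>R\<^esub> f u) \<rparr>"

definition bidual_map ::
    "('a, 'c) ring_scheme \<Rightarrow> ('a, 'b, 'd) module_scheme \<Rightarrow> 'b \<Rightarrow> ('b \<Rightarrow> 'a) \<Rightarrow> 'a"
  where "bidual_map R M u = (\<lambda>f\<in>carrier (dual_module R M). f u)"

text \<open>The canonical map to the bidual is always linear, so bijectivity makes it an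
  isomorphism of modules.\<close>

definition reflexive_module :: "('a, 'c) ring_scheme \<Rightarrow> ('a, 'b, 'd) module_scheme \<Rightarrow> bool"
  where "reflexive_module R M \<longleftrightarrow> module R M \<and>
    bij_betw (bidual_map R M) (carrier M) (carrier (dual_module R (dual_module R M)))"


section \<open>The polynomial ring and its fraction field\<close>

text \<open>\<open>\<complex>[x\<^sub>0, \<dots>, x\<^sub>l\<^sub>-\<^sub>1]\<close> is the set of those polynomials in countably many variables that
  involve only the variables with index below \<open>l\<close>. A monomial is its exponent vector.\<close>

type_synonym cpoly = "(nat \<Rightarrow>\<^sub>0 nat) \<Rightarrow>\<^sub>0 complex"

definition poly_carrier :: "nat \<Rightarrow> cpoly set"
  where "poly_carrier l = {p. \<forall>m\<in>Poly_Mapping.keys p. Poly_Mapping.keys m \<subseteq> {..<l}}"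

definition poly_ring :: "nat \<Rightarrow> cpoly ring"
  where "poly_ring l =
    \<lparr> carrier = poly_carrier l, mult = (*), one = 1, zero = 0, add = (+) \<rparr>"

definition partial_deriv :: "nat \<Rightarrow> cpoly \<Rightarrow> cpoly"
  where "partial_deriv i p = (\<Sum>m\<in>Poly_Mapping.keys p.
    Poly_Mapping.single (m - Poly_Mapping.single i 1)
      (of_nat (Poly_Mapping.lookup m i) * Poly_Mapping.lookup p m))"

definition frac_carrier :: "nat \<Rightarrow> cpoly fract set"
  where "frac_carrier l = {Fract p q | p q. p \<in> poly_carrier l \<and> q \<in> poly_carrier l \<and> q \<noteq> 0}"

text \<open>An element of \<open>Der(S)\<close> or \<open>\<Omega>\<^sup>1\<close> is its coefficient vector with respect to
  \<open>\<partial>/\<partial>x\<^sub>i\<close> or \<open>dx\<^sub>i\<close>, extended by 0 to the indices \<open>i \<ge> l\<close>; likewise after localization at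
  the ideal (0).\<close>

definition poly_vecs :: "nat \<Rightarrow> (nat \<Rightarrow> cpoly) set"
  where "poly_vecs l = {\<theta>. (\<forall>i<l. \<theta> i \<in> poly_carrier l) \<and> (\<forall>i\<ge>l. \<theta> i = 0)}"

definition frac_vecs :: "nat \<Rightarrow> (nat \<Rightarrow> cpoly fract) set"
  where "frac_vecs l = {\<theta>. (\<forall>i<l. \<theta> i \<in> frac_carrier l) \<and> (\<forall>i\<ge>l. \<theta> i = 0)}"

definition frac_vec_module :: "nat \<Rightarrow> (cpoly, nat \<Rightarrow> cpoly fract) module"
  where "frac_vec_module l =
    \<lparr> carrier = frac_vecs l, mult = undefined, one = undefined,
      zero = (\<lambda>i. 0), add = (\<lambda>\<theta> \<eta> i. \<theta> i + \<eta> i),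
      smult = (\<lambda>p \<theta> i. to_fract p * \<theta> i) \<rparr>"

definition der_apply :: "nat \<Rightarrow> (nat \<Rightarrow> cpoly) \<Rightarrow> cpoly \<Rightarrow> cpoly"
  where "der_apply l \<theta> f = (\<Sum>i<l. \<theta> i * partial_deriv i f)"

definition differential :: "nat \<Rightarrow> cpoly \<Rightarrow> nat \<Rightarrow> cpoly fract"
  where "differential l f = (\<lambda>i. if i < l then to_fract (partial_deriv i f) else 0)"

text \<open>The coefficient of \<open>dx\<^sub>i \<and> dx\<^sub>j\<close> (\<open>i < j\<close>) in \<open>\<eta> \<and> \<omega>\<close>.\<close>

definition wedge_coeff ::
    "(nat \<Rightarrow> cpoly fract) \<Rightarrow> (nat \<Rightarrow> cpoly fract) \<Rightarrow> nat \<Rightarrow> nat \<Rightarrow> cpoly fract"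
  where "wedge_coeff \<eta> \<omega> i j = \<eta> i * \<omega> j - \<eta> j * \<omega> i"

text \<open>\<open>f\<close> has no pole along the zero locus of the prime element \<open>a\<close>: \<open>f\<close> lies in the
  localization of \<open>S\<close> at the prime ideal \<open>(a)\<close>.\<close>

definition regular_along :: "nat \<Rightarrow> cpoly \<Rightarrow> cpoly fract \<Rightarrow> bool"
  where "regular_along l a f \<longleftrightarrow>
    (\<exists>p\<in>poly_carrier l. \<exists>q\<in>poly_carrier l. \<not> a divides\<^bsub>poly_ring l\<^esub> q \<and> f = Fract p q)"


section \<open>Linear forms and arrangements\<close>

text \<open>\<open>x 0, \<dots>, x (l - 1)\<close> is a basis of the dual space of the real vector space \<open>'v\<close>; this
  forces \<open>'v\<close> to have dimension \<open>l\<close>. The case \<open>l = 0\<close> is allowed.\<close>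

definition is_dual_basis :: "nat \<Rightarrow> (nat \<Rightarrow> 'v::real_vector \<Rightarrow> real) \<Rightarrow> bool"
  where "is_dual_basis l x \<longleftrightarrow> (\<forall>i<l. linear (x i)) \<and>
    (\<forall>f. linear f \<longrightarrow> (\<exists>!c. (\<forall>i\<ge>l. c i = (0::real)) \<and> f = (\<lambda>v. \<Sum>i<l. c i * x i v)))"

definition dual_coord ::
    "nat \<Rightarrow> (nat \<Rightarrow> 'v::real_vector \<Rightarrow> real) \<Rightarrow> ('v \<Rightarrow> real) \<Rightarrow> nat \<Rightarrow> real"
  where "dual_coord l x f =
    (THE c. (\<forall>i\<ge>l. c i = 0) \<and> f = (\<lambda>v. \<Sum>i<l. c i * x i v))"

definition form_poly ::
    "nat \<Rightarrow> (nat \<Rightarrow> 'v::real_vector \<Rightarrow> real) \<Rightarrow> ('v \<Rightarrow> real) \<Rightarrow> cpoly"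
  where "form_poly l x f =
    (\<Sum>i<l. Poly_Mapping.single (Poly_Mapping.single i 1) (complex_of_real (dual_coord l x f i)))"

text \<open>Only the values on linear forms matter.\<close>

definition dual_inner_product ::
    "(('v::real_vector \<Rightarrow> real) \<Rightarrow> ('v \<Rightarrow> real) \<Rightarrow> real) \<Rightarrow> bool"
  where "dual_inner_product I \<longleftrightarrow>
    (\<forall>f g. linear f \<longrightarrow> linear g \<longrightarrow> I f g = I g f) \<and>
    (\<forall>f g h. linear f \<longrightarrow> linear g \<longrightarrow> linear h \<longrightarrow>
      I (\<lambda>v. f v + g v) h = I f h + I g h) \<and>
    (\<forall>c f h. linear f \<longrightarrow> linear h \<longrightarrow> I (\<lambda>v. c * f v) h = c * I f h) \<and>
    (\<forall>f. linear f \<longrightarrow> f \<noteq> (\<lambda>v. 0) \<longrightarrow> I f f > 0)"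

definition linear_hyperplane :: "'v::real_vector set \<Rightarrow> bool"
  where "linear_hyperplane H \<longleftrightarrow> subspace H \<and> dim H + 1 = dim (UNIV :: 'v set)"

definition central_arrangement :: "'v::real_vector set set \<Rightarrow> bool"
  where "central_arrangement \<A> \<longleftrightarrow> finite \<A> \<and> (\<forall>H\<in>\<A>. linear_hyperplane H)"

definition defining_forms :: "'v::real_vector set set \<Rightarrow> ('v set \<Rightarrow> 'v \<Rightarrow> real) \<Rightarrow> bool"
  where "defining_forms \<A> \<alpha> \<longleftrightarrow> (\<forall>H\<in>\<A>. linear (\<alpha> H) \<and> {v. \<alpha> H v = 0} = H)"


section \<open>Logarithmic modules\<close>

definition arr_Q ::
    "nat \<Rightarrow> (nat \<Rightarrow> 'v::real_vector \<Rightarrow> real) \<Rightarrow> ('v set \<Rightarrow> 'v \<Rightarrow> real) \<Rightarrow>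
     'v set set \<Rightarrow> ('v set \<Rightarrow> nat) \<Rightarrow> cpoly"
  where "arr_Q l x \<alpha> \<B> n = (\<Prod>H\<in>\<B>. form_poly l x (\<alpha> H) ^ n H)"

definition log_der ::
    "nat \<Rightarrow> (nat \<Rightarrow> 'v::real_vector \<Rightarrow> real) \<Rightarrow> ('v set \<Rightarrow> 'v \<Rightarrow> real) \<Rightarrow>
     'v set set \<Rightarrow> ('v set \<Rightarrow> nat) \<Rightarrow> (nat \<Rightarrow> cpoly) set"
  where "log_der l x \<alpha> \<B> n = {\<theta> \<in> poly_vecs l. \<forall>H\<in>\<B>. \<exists>s\<in>poly_carrier l.
    der_apply l \<theta> (form_poly l x (\<alpha> H)) = s * form_poly l x (\<alpha> H) ^ n H}"

definition log_forms ::
    "nat \<Rightarrow> (nat \<Rightarrow> 'v::real_vector \<Rightarrow> real) \<Rightarrow> ('v set \<Rightarrow> 'v \<Rightarrow> real) \<Rightarrow>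
     'v set set \<Rightarrow> ('v set \<Rightarrow> nat) \<Rightarrow> (nat \<Rightarrow> cpoly fract) set"
  where "log_forms l x \<alpha> \<B> n =
    {\<omega> \<in> (\<lambda>\<eta> i. to_fract (\<eta> i) / to_fract (arr_Q l x \<alpha> \<B> n)) ` poly_vecs l.
      \<forall>H\<in>\<B>. \<forall>j<l. \<forall>i<j. regular_along l (form_poly l x (\<alpha> H))
        (wedge_coeff (differential l (form_poly l x (\<alpha> H))) \<omega> i j)}"

definition form_pairing ::
    "nat \<Rightarrow> (nat \<Rightarrow> 'v::real_vector \<Rightarrow> real) \<Rightarrow> (('v \<Rightarrow> real) \<Rightarrow> ('v \<Rightarrow> real) \<Rightarrow> real) \<Rightarrow>
     (nat \<Rightarrow> cpoly fract) \<Rightarrow> (nat \<Rightarrow> cpoly fract) \<Rightarrow> cpoly fract"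
  where "form_pairing l x I \<omega> \<eta> = (\<Sum>i<l. \<Sum>j<l.
    \<omega> i * \<eta> j * to_fract (Poly_Mapping.single 0 (complex_of_real (I (x i) (x j)))))"

text \<open>The isomorphism induced by the inner product: the coefficient of \<open>\<partial>/\<partial>x\<^sub>i\<close> in the
  derivation \<open>f \<mapsto> I(\<omega>, df)\<close> is its value at \<open>x\<^sub>i\<close>.\<close>

definition form_to_der ::
    "nat \<Rightarrow> (nat \<Rightarrow> 'v::real_vector \<Rightarrow> real) \<Rightarrow> (('v \<Rightarrow> real) \<Rightarrow> ('v \<Rightarrow> real) \<Rightarrow> real) \<Rightarrow>
     (nat \<Rightarrow> cpoly fract) \<Rightarrow> nat \<Rightarrow> cpoly fract"
  where "form_to_der l x I \<omega> = (\<lambda>i. if i < l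
    then form_pairing l x I \<omega> (differential l (form_poly l x (x i))) else 0)"

definition pos_part :: "'h set \<Rightarrow> ('h \<Rightarrow> int) \<Rightarrow> 'h set"
  where "pos_part \<A> m = {H \<in> \<A>. m H > 0}"

definition neg_part :: "'h set \<Rightarrow> ('h \<Rightarrow> int) \<Rightarrow> 'h set"
  where "neg_part \<A> m = {H \<in> \<A>. m H < 0}"

definition mult_restrict :: "'h set \<Rightarrow> ('h \<Rightarrow> int) \<Rightarrow> 'h \<Rightarrow> int"
  where "mult_restrict \<B> m H = (if H \<in> \<B> then m H else 0)"

definition DOmega ::
    "nat \<Rightarrow> (nat \<Rightarrow> 'v::real_vector \<Rightarrow> real) \<Rightarrow> (('v \<Rightarrow> real) \<Rightarrow> ('v \<Rightarrow> real) \<Rightarrow> real) \<Rightarrow>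
     ('v set \<Rightarrow> 'v \<Rightarrow> real) \<Rightarrow> 'v set set \<Rightarrow> ('v set \<Rightarrow> int) \<Rightarrow> (nat \<Rightarrow> cpoly fract) set"
  where "DOmega l x I \<alpha> \<A> m =
    (let m_pos = (\<lambda>H. nat (mult_restrict (pos_part \<A> m) m H));
         m_neg = (\<lambda>H. nat (- mult_restrict (neg_part \<A> m) m H));
         Q_neg = arr_Q l x \<alpha> (neg_part \<A> m) m_neg
     in (\<lambda>\<theta> i. to_fract (\<theta> i) / to_fract Q_neg) ` log_der l x \<alpha> (pos_part \<A> m) m_pos
        \<inter> form_to_der l x I ` log_forms l x \<alpha> (neg_part \<A> m) m_neg)"

definition DOmega_module ::
    "nat \<Rightarrow> (nat \<Rightarrow> 'v::real_vector \<Rightarrow> real) \<Rightarrow> (('v \<Rightarrow> real) \<Rightarrow> ('v \<Rightarrow> real) \<Rightarrow> real) \<Rightarrow>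
     ('v set \<Rightarrow> 'v \<Rightarrow> real) \<Rightarrow> 'v set set \<Rightarrow> ('v set \<Rightarrow> int) \<Rightarrow>
     (cpoly, nat \<Rightarrow> cpoly fract) module"
  where "DOmega_module l x I \<alpha> \<A> m = (frac_vec_module l)\<lparr> carrier := DOmega l x I \<alpha> \<A> m \<rparr>"

end

theory Submission
  imports Defs "Jordan_Normal_Form.Determinant"
begin

text \<open>The conditions that define \<open>D\<Omega>(\<A>, m)\<close> as a subset of \<open>K\<^sup>l\<close>, with \<open>K\<close> the fraction field of
  \<open>S\<close>, can all be written as \<open>c \<bullet> v \<in> S\<close> for \<open>c\<close> in some set \<open>C\<close> of vectors of fractions. This set
  has a common denominator and contains multiples of the unit vectors, so the module is a dual
  lattice, and dual lattices are reflexive. The pole conditions are brought to this form by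
  primality of \<open>\<alpha>\<^sub>H\<close>.\<close>

section \<open>Reflexive submodules of a vector space of fractions\<close>

text \<open>Regularity along \<open>H\<close> allows a denominator that varies with \<omega>. It can
  be traded for one fixed cofactor of Q because the form of \<open>H\<close> is prime and divides
  the form of no other hyperplane. Primality must hold in the ring of polynomials in the variables
  below \<open>l\<close>, where quotients have to avoid the other variables; it comes from
  eliminating a variable, as the kernel of a homomorphism into a domain is prime. The conditions on
  \<omega> concern the preimage of a derivation under the inner product and are transported by the
  inverse Gram matrix. Its entries are constants, so no new denominators arise, and the single
  condition that Q times the vector be polynomial serves both sides of the intersection. With a =
  \<open>Q_+\<close> and b = \<open>Q_-\<close>, the resulting M satisfies: a S^l lies in M, and b M
  lies in S^l. The first inclusion gives enough vectors to determine functionals, the second enough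
  functionals to separate vectors.\<close>

lemma poly_carrier_zero [simp, intro]: "0 \<in> poly_carrier l"
  by (simp add: poly_carrier_def)

lemma poly_carrier_one [simp, intro]: "1 \<in> poly_carrier l"
  by (simp add: poly_carrier_def)

lemma poly_carrier_add [intro]: "p \<in> poly_carrier l \<Longrightarrow> q \<in> poly_carrier l \<Longrightarrow> p + q \<in> poly_carrier l"
  using Poly_Mapping.keys_add[of p q] by (fastforce simp: poly_carrier_def)

lemma poly_carrier_uminus [intro]: "p \<in> poly_carrier l \<Longrightarrow> - p \<in> poly_carrier l"
  by (simp add: poly_carrier_def)

lemma poly_carrier_diff [intro]: "p \<in> poly_carrier l \<Longrightarrow> q \<in> poly_carrier l \<Longrightarrow> p - q \<in> poly_carrier l"
  using poly_carrier_add[of p l "- q"] by auto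

lemma poly_carrier_mult [intro]:
  assumes "p \<in> poly_carrier l" "q \<in> poly_carrier l"
  shows "p * q \<in> poly_carrier l"
  unfolding poly_carrier_def
proof (intro CollectI ballI)
  fix m
  assume "m \<in> Poly_Mapping.keys (p * q)"
  then obtain a b where "m = a + b" "a \<in> Poly_Mapping.keys p" "b \<in> Poly_Mapping.keys q"
    using Poly_Mapping.keys_mult[of p q] by blast
  then show "Poly_Mapping.keys m \<subseteq> {..<l}"
    using assms Poly_Mapping.keys_add[of a b] unfolding poly_carrier_def by blast
qed

lemma poly_carrier_sum [intro]:
  "(\<And>i. i \<in> A \<Longrightarrow> f i \<in> poly_carrier l) \<Longrightarrow> sum f A \<in> poly_carrier l"
  by (induction A rule: infinite_finite_induct) auto

lemma poly_carrier_prod [intro]: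
  "(\<And>i. i \<in> A \<Longrightarrow> f i \<in> poly_carrier l) \<Longrightarrow> prod f A \<in> poly_carrier l"
  by (induction A rule: infinite_finite_induct) auto

lemma poly_carrier_power [intro]: "p \<in> poly_carrier l \<Longrightarrow> p ^ n \<in> poly_carrier l"
  by (induction n) auto

lemma poly_carrier_const [simp, intro]: "Poly_Mapping.single 0 c \<in> poly_carrier l"
  by (simp add: poly_carrier_def)

lemma poly_carrier_var [intro]: "i < l \<Longrightarrow> Poly_Mapping.single (Poly_Mapping.single i 1) c \<in> poly_carrier l"
  by (simp add: poly_carrier_def)

definition poly_fracts :: "nat \<Rightarrow> cpoly fract set"
  where "poly_fracts l = to_fract ` poly_carrier l"

lemma to_fract_in_poly_fracts [simp]: "to_fract p \<in> poly_fracts l \<longleftrightarrow> p \<in> poly_carrier l"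
  by (auto simp: poly_fracts_def)

lemma poly_fracts_zero [simp, intro]: "0 \<in> poly_fracts l"
  using to_fract_in_poly_fracts[of 0 l] by simp

lemma poly_fracts_add [intro]:
  "f \<in> poly_fracts l \<Longrightarrow> g \<in> poly_fracts l \<Longrightarrow> f + g \<in> poly_fracts l"
  by (auto simp: poly_fracts_def simp flip: to_fract_add)

lemma poly_fracts_diff [intro]:
  "f \<in> poly_fracts l \<Longrightarrow> g \<in> poly_fracts l \<Longrightarrow> f - g \<in> poly_fracts l"
  by (auto simp: poly_fracts_def simp flip: to_fract_diff)

lemma poly_fracts_mult [intro]:
  "f \<in> poly_fracts l \<Longrightarrow> g \<in> poly_fracts l \<Longrightarrow> f * g \<in> poly_fracts l"
  by (auto simp: poly_fracts_def simp flip: to_fract_mult)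

text \<open>Values of functionals in the dual module are polynomials, whereas
  \<open>frac_dot\<close> yields fractions; \<open>poly_of\<close> carries the integral ones
  back.\<close>

definition poly_of :: "cpoly fract \<Rightarrow> cpoly"
  where "poly_of = inv_into UNIV to_fract"

lemma poly_of_to_fract [simp]: "poly_of (to_fract p) = p"
  by (simp add: poly_of_def inj_def)

lemma poly_of_in_poly_carrier [intro]: "f \<in> poly_fracts l \<Longrightarrow> poly_of f \<in> poly_carrier l"
  by (auto simp: poly_fracts_def)

lemma to_fract_poly_of: "f \<in> poly_fracts l \<Longrightarrow> to_fract (poly_of f) = f"
  by (auto simp: poly_fracts_def)

lemma poly_of_eqI: "f = to_fract p \<Longrightarrow> poly_of f = p"
  by simp

lemma frac_carrierI:
  "p \<in> poly_carrier l \<Longrightarrow> q \<in> poly_carrier l \<Longrightarrow> q \<noteq> 0 \<Longrightarrow> to_fract p / to_fract q \<in> frac_carrier l"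
  unfolding frac_carrier_def Fract_conv_to_fract by blast

lemma frac_carrier_to_fract [intro]: "p \<in> poly_carrier l \<Longrightarrow> to_fract p \<in> frac_carrier l"
  using frac_carrierI[of p l 1] by simp

lemma frac_carrierE:
  assumes "f \<in> frac_carrier l"
  obtains p q where "p \<in> poly_carrier l" "q \<in> poly_carrier l" "q \<noteq> 0" "f = to_fract p / to_fract q"
  using assms unfolding frac_carrier_def Fract_conv_to_fract by blast

lemma frac_carrier_zero [simp, intro]: "0 \<in> frac_carrier l"
  using frac_carrier_to_fract[of 0 l] by simp

lemma frac_carrier_add [intro]:
  assumes "f \<in> frac_carrier l" "g \<in> frac_carrier l"
  shows "f + g \<in> frac_carrier l"
proof -
  obtain p q r s where *: "p \<in> poly_carrier l" "q \<in> poly_carrier l" "q \<noteq> 0" "f = to_fract p / to_fract q"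
    "r \<in> poly_carrier l" "s \<in> poly_carrier l" "s \<noteq> 0" "g = to_fract r / to_fract s"
    using assms by (elim frac_carrierE) blast
  then have "f + g = to_fract (p * s + r * q) / to_fract (q * s)"
    by (simp add: field_simps)
  moreover have "p * s + r * q \<in> poly_carrier l" "q * s \<in> poly_carrier l" "q * s \<noteq> 0"
    using * by auto
  ultimately show ?thesis
    using frac_carrierI by metis
qed

lemma frac_carrier_mult [intro]:
  assumes "f \<in> frac_carrier l" "g \<in> frac_carrier l"
  shows "f * g \<in> frac_carrier l"
proof -
  obtain p q r s where *: "p \<in> poly_carrier l" "q \<in> poly_carrier l" "q \<noteq> 0" "f = to_fract p / to_fract q"
    "r \<in> poly_carrier l" "s \<in> poly_carrier l" "s \<noteq> 0" "g = to_fract r / to_fract s"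
    using assms by (elim frac_carrierE) blast
  then have "f * g = to_fract (p * r) / to_fract (q * s)"
    by simp
  moreover have "p * r \<in> poly_carrier l" "q * s \<in> poly_carrier l" "q * s \<noteq> 0"
    using * by auto
  ultimately show ?thesis
    using frac_carrierI by metis
qed

lemma poly_ring_simps [simp]:
  "carrier (poly_ring l) = poly_carrier l" "mult (poly_ring l) = (*)" "one (poly_ring l) = 1"
  "zero (poly_ring l) = 0" "add (poly_ring l) = (+)"
  by (simp_all add: poly_ring_def)

lemma poly_ring_cring: "cring (poly_ring l)"
proof (rule cringI)
  show "abelian_group (poly_ring l)"
  proof (rule abelian_groupI)
    fix p
    assume "p \<in> carrier (poly_ring l)"
    then show "\<exists>q\<in>carrier (poly_ring l). q \<oplus>\<^bsub>poly_ring l\<^esub> p = \<zero>\<^bsub>poly_ring l\<^esub>"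
      by (auto intro!: bexI[of _ "- p"])
  qed (auto simp: algebra_simps)
  show "Group.comm_monoid (poly_ring l)"
    by (rule comm_monoidI) (auto simp: algebra_simps)
qed (auto simp: algebra_simps)

section \<open>Lattices cut out by integrality of pairings\<close>

definition frac_dot :: "nat \<Rightarrow> (nat \<Rightarrow> cpoly fract) \<Rightarrow> (nat \<Rightarrow> cpoly fract) \<Rightarrow> cpoly fract"
  where "frac_dot l c v = (\<Sum>i<l. c i * v i)"

definition dual_lattice :: "nat \<Rightarrow> (nat \<Rightarrow> cpoly fract) set \<Rightarrow> (nat \<Rightarrow> cpoly fract) set"
  where "dual_lattice l C = {v \<in> frac_vecs l. \<forall>c\<in>C. frac_dot l c v \<in> poly_fracts l}"

abbreviation submodule_of_fracs ::
    "nat \<Rightarrow> (nat \<Rightarrow> cpoly fract) set \<Rightarrow> (cpoly, nat \<Rightarrow> cpoly fract) module"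
  where "submodule_of_fracs l M \<equiv> (frac_vec_module l)\<lparr> carrier := M \<rparr>"

lemma submodule_of_fracs_simps [simp]:
  "carrier (submodule_of_fracs l M) = M" "zero (submodule_of_fracs l M) = (\<lambda>i. 0)"
  "add (submodule_of_fracs l M) = (\<lambda>u v i. u i + v i)"
  "smult (submodule_of_fracs l M) = (\<lambda>p u i. to_fract p * u i)"
  by (simp_all add: frac_vec_module_def)

lemma frac_dot_zero [simp]: "frac_dot l c (\<lambda>i. 0) = 0"
  by (simp add: frac_dot_def)

lemma frac_dot_add: "frac_dot l c (\<lambda>i. u i + v i) = frac_dot l c u + frac_dot l c v"
  by (simp add: frac_dot_def algebra_simps sum.distrib)

lemma frac_dot_smult: "frac_dot l c (\<lambda>i. a * u i) = a * frac_dot l c u"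
  by (simp add: frac_dot_def algebra_simps sum_distrib_left)

lemma frac_dot_unit:
  assumes "i < l"
  shows "frac_dot l (\<lambda>j. if j = i then a else 0) v = a * v i"
    and "frac_dot l v (\<lambda>j. if j = i then a else 0) = a * v i"
proof -
  have "frac_dot l (\<lambda>j. if j = i then a else 0) v = (\<Sum>j<l. if j = i then a * v i else 0)"
    unfolding frac_dot_def by (rule sum.cong) auto
  then show "frac_dot l (\<lambda>j. if j = i then a else 0) v = a * v i"
    using assms by simp
  have "frac_dot l v (\<lambda>j. if j = i then a else 0) = (\<Sum>j<l. if j = i then a * v i else 0)"
    unfolding frac_dot_def by (rule sum.cong) auto
  then show "frac_dot l v (\<lambda>j. if j = i then a else 0) = a * v i"
    using assms by simp
qed

lemma dual_lattice_zero: "(\<lambda>i. 0) \<in> dual_lattice l C"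
  by (simp add: dual_lattice_def frac_vecs_def)

lemma dual_lattice_add:
  "u \<in> dual_lattice l C \<Longrightarrow> v \<in> dual_lattice l C \<Longrightarrow> (\<lambda>i. u i + v i) \<in> dual_lattice l C"
  by (auto simp: dual_lattice_def frac_vecs_def frac_dot_add)

lemma dual_lattice_smult:
  "p \<in> poly_carrier l \<Longrightarrow> u \<in> dual_lattice l C \<Longrightarrow> (\<lambda>i. to_fract p * u i) \<in> dual_lattice l C"
  by (auto simp: dual_lattice_def frac_vecs_def frac_dot_smult)

lemma dual_lattice_module: "module (poly_ring l) (submodule_of_fracs l (dual_lattice l C))"
proof (rule moduleI)
  show "abelian_group (submodule_of_fracs l (dual_lattice l C))"
  proof (rule abelian_groupI)
    fix u
    assume "u \<in> carrier (submodule_of_fracs l (dual_lattice l C))"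
    then show "\<exists>v\<in>carrier (submodule_of_fracs l (dual_lattice l C)).
        v \<oplus>\<^bsub>submodule_of_fracs l (dual_lattice l C)\<^esub> u = \<zero>\<^bsub>submodule_of_fracs l (dual_lattice l C)\<^esub>"
      using dual_lattice_smult[OF poly_carrier_uminus[OF poly_carrier_one], of u l C] by (auto intro!: bexI[of _ "\<lambda>i. to_fract (- 1) * u i"])
  qed (auto simp: dual_lattice_zero dual_lattice_add add.assoc add.commute)
qed (auto simp: poly_ring_cring dual_lattice_smult ring_distribs mult.assoc)

lemma dual_module_simps:
  "carrier (dual_module R M) = {f \<in> carrier M \<rightarrow>\<^sub>E carrier R.
        (\<forall>u\<in>carrier M. \<forall>v\<in>carrier M. f (u \<oplus>\<^bsub>M\<^esub> v) = f u \<oplus>\<^bsub>R\<^esub> f v) \<and>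
        (\<forall>a\<in>carrier R. \<forall>u\<in>carrier M. f (a \<odot>\<^bsub>M\<^esub> u) = a \<otimes>\<^bsub>R\<^esub> f u)}"
  "zero (dual_module R M) = (\<lambda>u\<in>carrier M. \<zero>\<^bsub>R\<^esub>)"
  "add (dual_module R M) = (\<lambda>f g. \<lambda>u\<in>carrier M. f u \<oplus>\<^bsub>R\<^esub> g u)"
  "smult (dual_module R M) = (\<lambda>a f. \<lambda>u\<in>carrier M. a \<otimes>\<^bsub>R\<^esub> f u)"
  by (simp_all add: dual_module_def)

text \<open>Functionals on a full lattice are given by vectors of fractions, and so are the functionals on
  its dual. Evaluating the functional given by an element of \<open>C\<close> at the vector that represents
  an element of the bidual gives a polynomial, so that vector lies in the lattice.\<close>

theorem dual_lattice_reflexive: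
  assumes b: "b \<in> poly_carrier l" "b \<noteq> 0"
    and bC: "\<And>i. i < l \<Longrightarrow> (\<lambda>j. if j = i then to_fract b else 0) \<in> C"
    and a: "a \<in> poly_carrier l" "a \<noteq> 0"
    and aC: "\<And>c i. c \<in> C \<Longrightarrow> i < l \<Longrightarrow> to_fract a * c i \<in> poly_fracts l"
  shows "reflexive_module (poly_ring l) (submodule_of_fracs l (dual_lattice l C))"
proof -
  define M where "M = dual_lattice l C"
  let ?D = "dual_module (poly_ring l) (submodule_of_fracs l M)"
  let ?DD = "dual_module (poly_ring l) ?D"
  have D: "carrier ?D = {f \<in> M \<rightarrow>\<^sub>E poly_carrier l.
      (\<forall>u\<in>M. \<forall>v\<in>M. f (\<lambda>i. u i + v i) = f u + f v) \<and>
      (\<forall>p\<in>poly_carrier l. \<forall>u\<in>M. f (\<lambda>i. to_fract p * u i) = p * f u)}"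
    by (simp add: dual_module_simps)
  have DD: "carrier ?DD = {\<Phi> \<in> carrier ?D \<rightarrow>\<^sub>E poly_carrier l.
      (\<forall>f\<in>carrier ?D. \<forall>g\<in>carrier ?D. \<Phi> (\<lambda>u\<in>M. f u + g u) = \<Phi> f + \<Phi> g) \<and>
      (\<forall>p\<in>poly_carrier l. \<forall>f\<in>carrier ?D. \<Phi> (\<lambda>u\<in>M. p * f u) = p * \<Phi> f)}"
    by (subst dual_module_simps(1)) (simp add: dual_module_simps(3,4))
  note M_simps = dual_lattice_zero[of l C, folded M_def] dual_lattice_add[of _ l C, folded M_def]
    dual_lattice_smult[of _ l _ C, folded M_def]
  \<comment> \<open>Since \<open>a\<close> clears the denominators of all of \<open>C\<close>, these
    multiples of the unit vectors lie in \<open>M\<close>.\<close>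
  define e where "e i = (\<lambda>j. if j = i then to_fract a else 0)" for i :: nat
  have e: "e i \<in> M" if "i < l" for i
    using a aC that by (auto simp: M_def dual_lattice_def e_def frac_vecs_def frac_dot_unit)
  have bM: "to_fract b * u i \<in> poly_fracts l" if "u \<in> M" "i < l" for u i
    using that bC[of i] by (auto simp: M_def dual_lattice_def frac_dot_unit)
  have fun_of: "(\<lambda>u\<in>M. poly_of (frac_dot l c u)) \<in> carrier ?D"
    if "\<And>u. u \<in> M \<Longrightarrow> frac_dot l c u \<in> poly_fracts l" for c
    unfolding D using that that[THEN to_fract_poly_of]
    by (auto simp: M_simps frac_dot_add frac_dot_smult intro!: poly_of_eqI)
  \<comment> \<open>The functionals that belong to the multiples of unit vectors supplied by
    \<open>bC\<close>: coordinates, scaled by \<open>b\<close> to become polynomial.\<close>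
  define F where "F i = (\<lambda>u\<in>M. poly_of (to_fract b * u i))" for i
  have F: "F i \<in> carrier ?D" if "i < l" for i
    using fun_of[of "\<lambda>j. if j = i then to_fract b else 0"] that bM by (simp add: F_def frac_dot_unit)
  have F_eq: "to_fract (F i u) = to_fract b * u i" if "i < l" "u \<in> M" for i u
    using that by (simp add: F_def to_fract_poly_of[OF bM])
  \<comment> \<open>The vector a b u is the combination of the \<open>e i\<close> with the
    polynomial coefficients \<open>F i u\<close>, so the values at the \<open>e i\<close> determine
    a functional.\<close>
  have D_rep: "a * b * f u = (\<Sum>i<l. f (e i) * F i u)" if f: "f \<in> carrier ?D" and u: "u \<in> M" for f u
  proof -
    \<comment> \<open>The first \<open>k\<close> coordinates of a b u. Additivity is given for two
      vectors at a time, hence the induction.\<close>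
    define w where "w k = (\<lambda>i. if i < k then to_fract a * (to_fract b * u i) else 0)" for k
    have "w k \<in> M \<and> f (w k) = (\<Sum>i<k. f (e i) * F i u)" if "k \<le> l" for k
      using that
    proof (induction k)
      case 0
      have "f (\<lambda>i. to_fract p * v i) = p * f v" if "p \<in> poly_carrier l" "v \<in> M" for p v
        using f that unfolding D by blast
      from this[OF poly_carrier_zero M_simps(1)] show ?case
        by (simp add: w_def M_simps)
    next
      case (Suc k)
      let ?x = "\<lambda>i. to_fract (F k u) * e k i"
      have "w (Suc k) = (\<lambda>i. w k i + ?x i)"
        using Suc.prems u by (auto simp: w_def e_def F_eq fun_eq_iff less_Suc_eq)
      moreover have Fk: "F k u \<in> poly_carrier l"
        using F[of k] Suc.prems u unfolding D by auto
      moreover have x: "?x \<in> M"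
        using Fk e Suc.prems M_simps(3) by simp
      moreover have "f ?x = F k u * f (e k)"
        using f Fk e Suc.prems unfolding D by auto
      ultimately show ?case
        using Suc f M_simps(2) unfolding D by (auto simp: mult.commute)
    qed
    from this[of l] have "f (w l) = (\<Sum>i<l. f (e i) * F i u)"
      by simp
    moreover have "w l = (\<lambda>i. to_fract (a * b) * u i)"
      using u by (auto simp: w_def M_def dual_lattice_def frac_vecs_def fun_eq_iff mult.assoc)
    moreover have "f (\<lambda>i. to_fract (a * b) * u i) = a * b * f u"
      using f u poly_carrier_mult[OF a(1) b(1)] unfolding D by blast
    ultimately show ?thesis
      by simp
  qed
  \<comment> \<open>With \<open>u\<close> left free, \<open>D_rep\<close> is an identity in the
    dual: a b f is the combination of the \<open>F i\<close> with coefficients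
    \<open>f (e i)\<close>. Applying \<Phi> shows that \<Phi> is determined by its values at the
    \<open>F i\<close>.\<close>
  have DD_rep: "a * b * \<Phi> f = (\<Sum>i<l. f (e i) * \<Phi> (F i))"
    if \<Phi>: "\<Phi> \<in> carrier ?DD" and f: "f \<in> carrier ?D" for \<Phi> f
  proof -
    \<comment> \<open>Partial sums of that identity; each must be known to lie in the dual before
      linearity of \<Phi> applies to it.\<close>
    define h where "h k = (\<lambda>u\<in>M. \<Sum>i<k. f (e i) * F i u)" for k
    have fe: "f (e i) \<in> poly_carrier l" if "i < l" for i
      using f e that unfolding D by auto
    have smult_D: "(\<lambda>u\<in>M. p * g u) \<in> carrier ?D" if "g \<in> carrier ?D" "p \<in> poly_carrier l" for p g
      using that M_simps unfolding D by (auto simp: algebra_simps)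
    have add_D: "(\<lambda>u\<in>M. g u + g' u) \<in> carrier ?D" if "g \<in> carrier ?D" "g' \<in> carrier ?D" for g g'
      using that M_simps unfolding D by (auto simp: algebra_simps)
    have "h k \<in> carrier ?D \<and> \<Phi> (h k) = (\<Sum>i<k. f (e i) * \<Phi> (F i))" if "k \<le> l" for k
      using that
    proof (induction k)
      case 0
      have h0: "h 0 = (\<lambda>u\<in>M. 0 * f u)"
        by (auto simp: h_def)
      have "\<Phi> (\<lambda>u\<in>M. 0 * f u) = 0 * \<Phi> f"
        using f \<Phi> poly_carrier_zero unfolding DD by blast
      then have "\<Phi> (h 0) = 0"
        unfolding h0 by (simp only: mult_zero_left)
      moreover have "h 0 \<in> carrier ?D"
        unfolding h0 by (rule smult_D[OF f poly_carrier_zero])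
      ultimately show ?case
        by (simp only: lessThan_0 sum.empty simp_thms)
    next
      case (Suc k)
      let ?x = "\<lambda>u\<in>M. f (e k) * F k u"
      have hSuc: "h (Suc k) = (\<lambda>u\<in>M. h k u + ?x u)"
        by (auto simp: h_def fun_eq_iff)
      have x: "?x \<in> carrier ?D"
        using smult_D F fe Suc.prems by simp
      have \<Phi>x: "\<Phi> ?x = f (e k) * \<Phi> (F k)"
        using \<Phi> F fe Suc.prems unfolding DD by auto
      have hk: "h k \<in> carrier ?D" "\<Phi> (h k) = (\<Sum>i<k. f (e i) * \<Phi> (F i))"
        using Suc by auto
      have "\<Phi> (\<lambda>u\<in>M. h k u + ?x u) = \<Phi> (h k) + \<Phi> ?x"
        using \<Phi> x hk unfolding DD by blast
      then have "\<Phi> (h (Suc k)) = (\<Sum>i<Suc k. f (e i) * \<Phi> (F i))"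
        unfolding hSuc by (simp only: hk \<Phi>x sum.lessThan_Suc)
      moreover have "h (Suc k) \<in> carrier ?D"
        unfolding hSuc by (rule add_D[OF hk(1) x])
      ultimately show ?case
        by blast
    qed
    from this[of l] have "\<Phi> (h l) = (\<Sum>i<l. f (e i) * \<Phi> (F i))"
      by simp
    moreover have "h l = (\<lambda>u\<in>M. a * b * f u)"
      using D_rep[OF f] by (auto simp: h_def fun_eq_iff)
    ultimately show ?thesis
      using f a b \<Phi> poly_carrier_mult[OF a(1) b(1)] unfolding DD by auto
  qed
  have inj: "inj_on (bidual_map (poly_ring l) (submodule_of_fracs l M)) M"
  proof (rule inj_onI)
    fix u v
    assume uv: "u \<in> M" "v \<in> M" and
      eq: "bidual_map (poly_ring l) (submodule_of_fracs l M) u = bidual_map (poly_ring l) (submodule_of_fracs l M) v"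
    have *: "f u = f v" if "f \<in> carrier ?D" for f
      using fun_cong[OF eq, of f] that by (simp add: bidual_map_def)
    have "u i = v i" if "i < l" for i
      using *[OF F[OF that]] F_eq[OF that] uv b by (metis mult_left_cancel to_fract_eq_0_iff)
    moreover have "u i = v i" if "i \<ge> l" for i
      using uv that by (simp add: M_def dual_lattice_def frac_vecs_def)
    ultimately show "u = v"
      by (metis ext linorder_not_less)
  qed
  have maps: "bidual_map (poly_ring l) (submodule_of_fracs l M) u \<in> carrier ?DD" if u: "u \<in> M" for u
  proof -
    have "(\<lambda>v\<in>M. f v + g v) \<in> carrier ?D" if "f \<in> carrier ?D" "g \<in> carrier ?D" for f g
      using that M_simps unfolding D by (auto simp: algebra_simps)
    moreover have "(\<lambda>v\<in>M. p * f v) \<in> carrier ?D" if "f \<in> carrier ?D" "p \<in> poly_carrier l" for f p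
      using that M_simps unfolding D by (auto simp: algebra_simps)
    moreover have "f u \<in> poly_carrier l" if "f \<in> carrier ?D" for f
      using that u unfolding D by auto
    ultimately show ?thesis
      unfolding DD bidual_map_def using u by simp
  qed
  have surj: "\<exists>v\<in>M. \<Phi> = bidual_map (poly_ring l) (submodule_of_fracs l M) v" if \<Phi>: "\<Phi> \<in> carrier ?DD" for \<Phi>
  proof -
    \<comment> \<open>The choice is forced: evaluation at \<open>v\<close> sends \<open>F i\<close>
      to \<open>b * v i\<close>.\<close>
    define v where "v i = (if i < l then to_fract (\<Phi> (F i)) / to_fract b else 0)" for i
    have \<Phi>_carrier: "\<Phi> f \<in> poly_carrier l" if "f \<in> carrier ?D" for f
      using \<Phi> that unfolding DD by auto
    have v_frac: "v \<in> frac_vecs l"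
      using b F \<Phi>_carrier by (auto simp: frac_vecs_def v_def intro!: frac_carrierI)
    have rep: "to_fract (a * \<Phi> f) = (\<Sum>i<l. to_fract (f (e i)) * v i)" if f: "f \<in> carrier ?D" for f
    proof -
      have "to_fract b * to_fract (a * \<Phi> f) = to_fract (a * b * \<Phi> f)"
        by (simp add: algebra_simps)
      also have "\<dots> = to_fract b * (\<Sum>i<l. to_fract (f (e i)) * v i)"
        unfolding DD_rep[OF \<Phi> f] using b by (simp add: v_def sum_distrib_left)
      finally show ?thesis
        using b by simp
    qed
    have v: "v \<in> M"
      unfolding M_def dual_lattice_def
    proof (intro CollectI conjI ballI v_frac)
      fix c
      assume c: "c \<in> C"
      let ?f = "\<lambda>u\<in>M. poly_of (frac_dot l c u)"
      have cM: "frac_dot l c u \<in> poly_fracts l" if "u \<in> M" for u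
        using that c by (simp add: M_def dual_lattice_def)
      have f: "?f \<in> carrier ?D"
        by (rule fun_of) (rule cM)
      \<comment> \<open>The functional of \<open>c\<close> has the value a c_i at
        \<open>e i\<close>. Once \<open>a\<close> is cancelled, \<open>rep\<close> says that the
        pairing of \<open>c\<close> with \<open>v\<close> equals \<Phi> at this functional, which is
        a polynomial.\<close>
      have "to_fract (?f (e i)) = to_fract a * c i" if "i < l" for i
        using e[OF that] to_fract_poly_of[OF cM[OF e[OF that]]] that
        by (simp add: e_def frac_dot_unit)
      then have "to_fract a * to_fract (\<Phi> ?f) = (\<Sum>i<l. to_fract a * (c i * v i))"
        using rep[OF f] by (simp add: mult.assoc)
      then have "frac_dot l c v = to_fract (\<Phi> ?f)"
        using a by (simp add: frac_dot_def flip: sum_distrib_left)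
      then show "frac_dot l c v \<in> poly_fracts l"
        using \<Phi>_carrier[OF f] by simp
    qed
    have "\<Phi> f = f v" if f: "f \<in> carrier ?D" for f
    proof -
      \<comment> \<open>\<open>rep\<close> and \<open>D_rep\<close> at \<open>v\<close> express a b
        \<Phi>(f) and a b f(v) by the same sum.\<close>
      have "to_fract b * to_fract (a * \<Phi> f) = to_fract b * (\<Sum>i<l. to_fract (f (e i)) * v i)"
        by (simp only: rep[OF f])
      also have "\<dots> = to_fract (\<Sum>i<l. f (e i) * F i v)"
        using F_eq v by (simp add: sum_distrib_left algebra_simps)
      also have "\<dots> = to_fract b * to_fract (a * f v)"
        unfolding D_rep[OF f v, symmetric] by (simp add: algebra_simps)
      finally show ?thesis
        using a b by simp
    qed
    moreover have "\<Phi> \<in> extensional (carrier ?D)"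
      using \<Phi> unfolding DD by (simp add: PiE_iff)
    ultimately have "\<Phi> = bidual_map (poly_ring l) (submodule_of_fracs l M) v"
      unfolding bidual_map_def by (auto simp: fun_eq_iff extensional_def)
    then show ?thesis
      using v by blast
  qed
  have "bij_betw (bidual_map (poly_ring l) (submodule_of_fracs l M)) M (carrier ?DD)"
    unfolding bij_betw_def using inj maps surj by blast
  then show ?thesis
    using dual_lattice_module[of l C] by (simp add: reflexive_module_def M_def)
qed

section \<open>Substitution and divisibility by linear forms\<close>

lemma poly_mapping_sum_single:
  fixes p :: "'a \<Rightarrow>\<^sub>0 'b :: comm_monoid_add"
  shows "p = (\<Sum>k\<in>Poly_Mapping.keys p. Poly_Mapping.single k (Poly_Mapping.lookup p k))"
  by (rule poly_mapping_eqI) (auto simp: lookup_sum lookup_single when_def in_keys_iff sum.delta)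

lemma poly_mapping_add_induct [case_names zero single add]:
  fixes p :: "'a \<Rightarrow>\<^sub>0 'b :: comm_monoid_add"
  assumes "P 0" "\<And>k c. P (Poly_Mapping.single k c)" "\<And>p q. P p \<Longrightarrow> P q \<Longrightarrow> P (p + q)"
  shows "P p"
proof -
  have "P (\<Sum>k\<in>A. Poly_Mapping.single k (Poly_Mapping.lookup p k))" for A
    by (induction A rule: infinite_finite_induct) (auto intro: assms)
  then show ?thesis
    by (subst poly_mapping_sum_single)
qed

definition poly_var :: "nat \<Rightarrow> cpoly"
  where "poly_var i = Poly_Mapping.single (Poly_Mapping.single i 1) 1"

definition subst_monom :: "(nat \<Rightarrow> cpoly) \<Rightarrow> (nat \<Rightarrow>\<^sub>0 nat) \<Rightarrow> cpoly"
  where "subst_monom f m = (\<Prod>i\<in>Poly_Mapping.keys m. f i ^ Poly_Mapping.lookup m i)"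

definition poly_subst :: "(nat \<Rightarrow> cpoly) \<Rightarrow> cpoly \<Rightarrow> cpoly"
  where "poly_subst f p = (\<Sum>m\<in>Poly_Mapping.keys p.
    Poly_Mapping.single 0 (Poly_Mapping.lookup p m) * subst_monom f m)"

lemma subst_monom_superset:
  "finite A \<Longrightarrow> Poly_Mapping.keys m \<subseteq> A \<Longrightarrow> subst_monom f m = (\<Prod>i\<in>A. f i ^ Poly_Mapping.lookup m i)"
  unfolding subst_monom_def by (rule prod.mono_neutral_left) (auto simp: in_keys_iff)

lemma subst_monom_add: "subst_monom f (m + n) = subst_monom f m * subst_monom f n"
proof -
  let ?A = "Poly_Mapping.keys m \<union> Poly_Mapping.keys n"
  have "subst_monom f (m + n) = (\<Prod>i\<in>?A. f i ^ Poly_Mapping.lookup (m + n) i)"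
    by (rule subst_monom_superset) (use Poly_Mapping.keys_add[of m n] in auto)
  also have "\<dots> = subst_monom f m * subst_monom f n"
    by (simp add: subst_monom_superset[of ?A m] subst_monom_superset[of ?A n] lookup_add power_add prod.distrib)
  finally show ?thesis .
qed

lemma poly_subst_zero [simp]: "poly_subst f 0 = 0"
  by (simp add: poly_subst_def)

lemma poly_subst_add: "poly_subst f (p + q) = poly_subst f p + poly_subst f q"
  unfolding poly_subst_def
  by (rule setsum_keys_plus_distrib) (simp_all add: single_add distrib_right)

lemma poly_subst_sum: "poly_subst f (\<Sum>i\<in>A. g i) = (\<Sum>i\<in>A. poly_subst f (g i))"
  by (induction A rule: infinite_finite_induct) (simp_all add: poly_subst_add)

lemma poly_subst_single: "poly_subst f (Poly_Mapping.single m c) = Poly_Mapping.single 0 c * subst_monom f m"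
  by (simp add: poly_subst_def)

lemma poly_subst_mult: "poly_subst f (p * q) = poly_subst f p * poly_subst f q"
proof (induction p rule: poly_mapping_add_induct)
  case (single m c)
  show ?case
  proof (induction q rule: poly_mapping_add_induct)
    case (single n d)
    have "Poly_Mapping.single 0 (c * d) = (Poly_Mapping.single 0 c * Poly_Mapping.single 0 d :: cpoly)"
      by (simp add: mult_single)
    then show ?case
      by (simp add: mult_single poly_subst_single subst_monom_add algebra_simps)
  qed (simp_all add: distrib_left poly_subst_add)
qed (simp_all add: distrib_right poly_subst_add)

lemma poly_subst_poly_var_scaled:
  "poly_subst f (Poly_Mapping.single (Poly_Mapping.single i 1) c) = Poly_Mapping.single 0 c * f i"
  by (simp add: poly_subst_single subst_monom_def)

lemma poly_var_power: "poly_var i ^ n = Poly_Mapping.single (Poly_Mapping.single i n) 1"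
  by (induction n) (simp_all add: poly_var_def mult_single flip: single_add)

lemma prod_single_one:
  "(\<Prod>i\<in>A. Poly_Mapping.single (g i) 1) = Poly_Mapping.single (\<Sum>i\<in>A. g i) (1 :: 'a :: comm_semiring_1)"
  by (induction A rule: infinite_finite_induct) (simp_all add: mult_single)

lemma subst_monom_poly_var: "subst_monom poly_var m = Poly_Mapping.single m 1"
  by (simp add: subst_monom_def poly_var_power prod_single_one flip: poly_mapping_sum_single)

lemma poly_subst_poly_var: "poly_subst poly_var p = p"
  by (induction p rule: poly_mapping_add_induct)
    (simp_all add: poly_subst_add poly_subst_single subst_monom_poly_var mult_single)

section \<open>Linear forms as prime elements\<close>

definition lin_poly :: "nat \<Rightarrow> (nat \<Rightarrow> complex) \<Rightarrow> cpoly"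
  where "lin_poly l c = (\<Sum>i<l. Poly_Mapping.single (Poly_Mapping.single i 1) (c i))"

lemma lin_poly_in_carrier [simp, intro]: "lin_poly l c \<in> poly_carrier l"
  unfolding lin_poly_def by (intro poly_carrier_sum poly_carrier_var) simp

lemma lookup_lin_poly:
  assumes "i < l"
  shows "Poly_Mapping.lookup (lin_poly l c) (Poly_Mapping.single i 1) = c i"
proof -
  have "Poly_Mapping.lookup (lin_poly l c) (Poly_Mapping.single i 1) = (\<Sum>j<l. if j = i then c i else 0)"
    unfolding lin_poly_def lookup_sum
    \<comment> \<open>Distinct variables are told apart by the supports of their exponent
      vectors.\<close>
    by (rule sum.cong) (auto simp: lookup_single when_def dest!: arg_cong[where f = Poly_Mapping.keys])
  then show ?thesis
    using assms by simp
qed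

lemma const_mult_lin_poly: "Poly_Mapping.single 0 a * lin_poly l c = lin_poly l (\<lambda>i. a * c i)"
  by (simp add: lin_poly_def sum_distrib_left mult_single)

lemma divides_poly_ring: "p divides\<^bsub>poly_ring l\<^esub> q \<longleftrightarrow> (\<exists>r\<in>poly_carrier l. q = p * r)"
  by (simp add: factor_def)

text \<open>Congruence modulo \<open>p\<close> respects products, by changing one factor at a time.
  The quotients are tracked in \<open>poly_carrier l\<close>, as divisibility in
  \<open>poly_ring l\<close> demands.\<close>

lemma divides_diff_prod:
  assumes "finite A" "\<And>i. i \<in> A \<Longrightarrow> f i \<in> poly_carrier l" "\<And>i. i \<in> A \<Longrightarrow> g i \<in> poly_carrier l"
    and "\<And>i. i \<in> A \<Longrightarrow> \<exists>r\<in>poly_carrier l. f i - g i = p * r"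
  shows "\<exists>r\<in>poly_carrier l. prod f A - prod g A = p * r"
  using assms
proof (induction A)
  case empty
  show ?case by (auto intro!: bexI[of _ 0])
next
  case (insert i A)
  obtain r where "r \<in> poly_carrier l" "f i - g i = p * r"
    using insert.prems by blast
  moreover obtain s where "s \<in> poly_carrier l" "prod f A - prod g A = p * s"
    using insert by blast
  moreover have "f i * prod f A - g i * prod g A = (f i - g i) * prod f A + g i * (prod f A - prod g A)"
    by (simp add: algebra_simps)
  ultimately have "f i * prod f A - g i * prod g A = p * (r * prod f A + g i * s)"
    by (simp add: algebra_simps)
  moreover have "r * prod f A + g i * s \<in> poly_carrier l"
    using insert.prems \<open>r \<in> _\<close> \<open>s \<in> _\<close> by auto
  ultimately show ?case
    using insert.hyps by auto
qed

text \<open>The identity is itself a substitution, by \<open>poly_var\<close>, so the two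
  polynomials can be compared monomial by monomial with \<open>divides_diff_prod\<close>.\<close>

lemma divides_diff_poly_subst:
  assumes f: "\<And>i. i < l \<Longrightarrow> f i \<in> poly_carrier l"
    and p: "\<And>i. i < l \<Longrightarrow> \<exists>r\<in>poly_carrier l. poly_var i - f i = p * r"
    and q: "q \<in> poly_carrier l"
  shows "\<exists>r\<in>poly_carrier l. q - poly_subst f q = p * r"
proof -
  have "\<exists>r\<in>poly_carrier l. subst_monom poly_var m - subst_monom f m = p * r"
    if "m \<in> Poly_Mapping.keys q" for m
  proof -
    have lt: "i < l" if "i \<in> Poly_Mapping.keys m" for i
      using that \<open>m \<in> _\<close> q by (auto simp: poly_carrier_def)
    have v: "poly_var i \<in> poly_carrier l" if "i < l" for i
      using that unfolding poly_var_def by (rule poly_carrier_var)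
    \<comment> \<open>A power is a product of equal factors, so the product lemma applies to
      constant families.\<close>
    have "\<exists>r\<in>poly_carrier l. poly_var i ^ n - f i ^ n = p * r" if "i < l" for i n
      using divides_diff_prod[of "{..<n}" "\<lambda>_. poly_var i" l "\<lambda>_. f i" p] p f v that by simp
    then show ?thesis
      unfolding subst_monom_def using f v lt by (intro divides_diff_prod) auto
  qed
  then obtain r where r: "r m \<in> poly_carrier l" "subst_monom poly_var m - subst_monom f m = p * r m"
    if "m \<in> Poly_Mapping.keys q" for m
    by metis
  have "q - poly_subst f q = poly_subst poly_var q - poly_subst f q"
    by (simp add: poly_subst_poly_var)
  also have "\<dots> = (\<Sum>m\<in>Poly_Mapping.keys q.
      Poly_Mapping.single 0 (Poly_Mapping.lookup q m) * (subst_monom poly_var m - subst_monom f m))"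
    by (simp add: poly_subst_def sum_subtractf right_diff_distrib)
  also have "\<dots> = p * (\<Sum>m\<in>Poly_Mapping.keys q. Poly_Mapping.single 0 (Poly_Mapping.lookup q m) * r m)"
    unfolding sum_distrib_left by (rule sum.cong) (simp_all add: r algebra_simps)
  finally show ?thesis
    using r by (intro bexI[of _ "\<Sum>m\<in>Poly_Mapping.keys q. Poly_Mapping.single 0 (Poly_Mapping.lookup q m) * r m"])
      auto
qed

text \<open>Eliminating a variable that occurs in a linear form is a ring endomorphism whose kernel is
  the ideal generated by the form.\<close>

definition eliminate :: "nat \<Rightarrow> (nat \<Rightarrow> complex) \<Rightarrow> nat \<Rightarrow> cpoly \<Rightarrow> cpoly"
  where "eliminate l c k = poly_subst
    (\<lambda>i. poly_var i - (if i = k then Poly_Mapping.single 0 (1 / c k) * lin_poly l c else 0))"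

lemma eliminate_mult: "eliminate l c k (p * q) = eliminate l c k p * eliminate l c k q"
  by (simp add: eliminate_def poly_subst_mult)

lemma eliminate_one: "eliminate l c k 1 = 1"
  unfolding eliminate_def using poly_subst_single[of _ 0 1] by (simp add: subst_monom_def)

text \<open>For nonzero \<open>c k\<close>, elimination subtracts the multiple of \<open>c\<close>
  that cancels the \<open>k\<close>-th coefficient; if \<open>d\<close> is proportional to
  \<open>c\<close>, nothing remains.\<close>

lemma eliminate_lin_poly:
  assumes "k < l"
  shows "eliminate l c k (lin_poly l d) = lin_poly l (\<lambda>i. d i - d k / c k * c i)"
proof -
  have "eliminate l c k (lin_poly l d) = (\<Sum>i<l. Poly_Mapping.single (Poly_Mapping.single i 1) (d i) -
      (if i = k then Poly_Mapping.single 0 (d k) * (Poly_Mapping.single 0 (1 / c k) * lin_poly l c) else 0))"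
    unfolding eliminate_def lin_poly_def[of l d] poly_subst_sum poly_subst_poly_var_scaled
    by (rule sum.cong) (simp_all add: right_diff_distrib poly_var_def mult_single)
  also have "\<dots> = lin_poly l d - Poly_Mapping.single 0 (d k) * (Poly_Mapping.single 0 (1 / c k) * lin_poly l c)"
    using assms by (simp add: sum_subtractf lin_poly_def)
  also have "\<dots> = lin_poly l (\<lambda>i. d i - d k / c k * c i)"
    by (simp add: const_mult_lin_poly) (simp add: lin_poly_def single_diff sum_subtractf mult_single)
  finally show ?thesis .
qed

lemma lin_poly_zero [simp]: "lin_poly l (\<lambda>i. 0) = 0"
  by (simp add: lin_poly_def)

lemma lin_poly_divides_iff:
  assumes "k < l" "c k \<noteq> 0" "p \<in> poly_carrier l"
  shows "lin_poly l c divides\<^bsub>poly_ring l\<^esub> p \<longleftrightarrow> eliminate l c k p = 0"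
proof
  assume "lin_poly l c divides\<^bsub>poly_ring l\<^esub> p"
  then obtain r where "p = lin_poly l c * r"
    by (auto simp: divides_poly_ring)
  then show "eliminate l c k p = 0"
    using assms by (simp add: eliminate_mult eliminate_lin_poly)
next
  assume *: "eliminate l c k p = 0"
  have "\<exists>r\<in>poly_carrier l. p - eliminate l c k p = lin_poly l c * r"
    unfolding eliminate_def
  proof (rule divides_diff_poly_subst)
    fix i
    assume "i < l"
    then have "poly_var i \<in> poly_carrier l"
      unfolding poly_var_def by (rule poly_carrier_var)
    then show "poly_var i - (if i = k then Poly_Mapping.single 0 (1 / c k) * lin_poly l c else 0) \<in> poly_carrier l"
      by auto
    show "\<exists>r\<in>poly_carrier l. poly_var i -
        (poly_var i - (if i = k then Poly_Mapping.single 0 (1 / c k) * lin_poly l c else 0)) = lin_poly l c * r"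
      by (auto intro: bexI[of _ "Poly_Mapping.single 0 (1 / c k)"] bexI[of _ 0])
  qed fact
  then show "lin_poly l c divides\<^bsub>poly_ring l\<^esub> p"
    by (simp add: * divides_poly_ring)
qed

text \<open>Primality of a nonzero linear form: it generates the kernel of a homomorphism into an
  integral domain.\<close>

lemma lin_poly_divides_mult:
  assumes "k < l" "c k \<noteq> 0" "p \<in> poly_carrier l" "q \<in> poly_carrier l"
    and "lin_poly l c divides\<^bsub>poly_ring l\<^esub> p * q"
  shows "lin_poly l c divides\<^bsub>poly_ring l\<^esub> p \<or> lin_poly l c divides\<^bsub>poly_ring l\<^esub> q"
  using assms poly_carrier_mult[of p l q] by (simp add: lin_poly_divides_iff eliminate_mult)

lemma lin_poly_divides_power:
  assumes "k < l" "c k \<noteq> 0" "p \<in> poly_carrier l"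
    and "lin_poly l c divides\<^bsub>poly_ring l\<^esub> p ^ n"
  shows "lin_poly l c divides\<^bsub>poly_ring l\<^esub> p"
proof -
  have "eliminate l c k (p ^ n) = 0 \<Longrightarrow> eliminate l c k p = 0"
    by (induction n) (auto simp: eliminate_mult eliminate_one)
  then show ?thesis
    using assms poly_carrier_power[of p l n] by (simp add: lin_poly_divides_iff)
qed

lemma lin_poly_divides_prod:
  assumes "k < l" "c k \<noteq> 0" "\<And>i. i \<in> A \<Longrightarrow> f i \<in> poly_carrier l"
    and "lin_poly l c divides\<^bsub>poly_ring l\<^esub> prod f A"
  obtains i where "i \<in> A" "lin_poly l c divides\<^bsub>poly_ring l\<^esub> f i"
proof -
  have "eliminate l c k (prod f A) = 0 \<Longrightarrow> \<exists>i\<in>A. eliminate l c k (f i) = 0"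
    by (induction A rule: infinite_finite_induct) (auto simp: eliminate_mult eliminate_one)
  moreover have "prod f A \<in> poly_carrier l"
    using assms by auto
  ultimately show thesis
    using assms that by (auto simp: lin_poly_divides_iff)
qed

text \<open>The eliminated form is 0 exactly when its coefficients are, so divisibility between
  linear forms amounts to proportionality.\<close>

lemma lin_poly_divides_lin_poly:
  assumes "k < l" "c k \<noteq> 0" "lin_poly l c divides\<^bsub>poly_ring l\<^esub> lin_poly l d" "i < l"
  shows "d i = d k / c k * c i"
proof -
  have "lin_poly l (\<lambda>i. d i - d k / c k * c i) = 0"
    using assms by (simp add: lin_poly_divides_iff eliminate_lin_poly)
  then show ?thesis
    using lookup_lin_poly[OF \<open>i < l\<close>, of "\<lambda>i. d i - d k / c k * c i"] by simp
qed

text \<open>One factor at a time: by primality the form divides \<open>p\<close>, as it does not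
  divide \<open>q\<close>, and this factor is cancelled.\<close>

lemma power_lin_poly_divides_mult:
  assumes "k < l" "c k \<noteq> 0" "p \<in> poly_carrier l" "q \<in> poly_carrier l"
    and "\<not> lin_poly l c divides\<^bsub>poly_ring l\<^esub> q"
    and "lin_poly l c ^ n divides\<^bsub>poly_ring l\<^esub> p * q"
  shows "lin_poly l c ^ n divides\<^bsub>poly_ring l\<^esub> p"
  using assms(3,6)
proof (induction n arbitrary: p)
  case 0
  then show ?case by (simp add: divides_poly_ring)
next
  case (Suc n)
  have ne: "lin_poly l c \<noteq> 0"
    using lookup_lin_poly[of k l c] assms by auto
  obtain r where r: "r \<in> poly_carrier l" "p * q = lin_poly l c * (lin_poly l c ^ n * r)"
    using Suc.prems by (auto simp: divides_poly_ring mult.assoc)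
  then have "lin_poly l c divides\<^bsub>poly_ring l\<^esub> p * q"
    unfolding divides_poly_ring by blast
  then have "lin_poly l c divides\<^bsub>poly_ring l\<^esub> p"
    using lin_poly_divides_mult[of k l c p q] assms Suc.prems by blast
  then obtain s where s: "s \<in> poly_carrier l" "p = lin_poly l c * s"
    by (auto simp: divides_poly_ring)
  then have "s * q = lin_poly l c ^ n * r"
    using r ne by (simp add: mult.assoc)
  then have "lin_poly l c ^ n divides\<^bsub>poly_ring l\<^esub> s"
    using Suc.IH[of s] s r by (auto simp: divides_poly_ring)
  then show ?case
    using s by (auto simp: divides_poly_ring mult.assoc)
qed

section \<open>Dual bases and inner products\<close>

lemma dual_coord_unique:
  assumes "is_dual_basis l x" "linear f" "\<And>i. i \<ge> l \<Longrightarrow> c i = 0" "f = (\<lambda>v. \<Sum>i<l. c i * x i v)"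
  shows "dual_coord l x f = c"
  unfolding dual_coord_def using assms
  by (intro the1_equality) (auto simp: is_dual_basis_def)

lemma dual_coord_eq:
  assumes "is_dual_basis l x" "linear f"
  shows "f = (\<lambda>v. \<Sum>i<l. dual_coord l x f i * x i v)" "i \<ge> l \<Longrightarrow> dual_coord l x f i = 0"
proof -
  obtain c where "\<forall>i\<ge>l. c i = 0" "f = (\<lambda>v. \<Sum>i<l. c i * x i v)"
    using assms unfolding is_dual_basis_def by metis
  moreover from this have "dual_coord l x f = c"
    by (intro dual_coord_unique assms) auto
  ultimately show "f = (\<lambda>v. \<Sum>i<l. dual_coord l x f i * x i v)" "i \<ge> l \<Longrightarrow> dual_coord l x f i = 0"
    by auto
qed

lemma dual_coord_basis:
  assumes "is_dual_basis l x" "i < l"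
  shows "dual_coord l x (x i) = (\<lambda>j. if j = i then 1 else 0)"
  by (rule dual_coord_unique)
    (use assms in \<open>auto simp: is_dual_basis_def if_distrib[of "\<lambda>a. a * _"] cong: if_cong\<close>)

lemma linear_combination_basis:
  assumes "is_dual_basis l x" "k \<le> l"
  shows "linear (\<lambda>v. \<Sum>i<k. c i * x i v :: real)"
  using assms(2)
proof (induction k)
  case (Suc k)
  moreover have "linear (x k)"
    using assms Suc.prems by (simp add: is_dual_basis_def)
  from linear_compose_scale_right[OF this, of "c k"] have "linear (\<lambda>v. c k * x k v)"
    by simp
  ultimately show ?case
    by (auto intro: linear_compose_add)
qed (simp add: linear_zero)

lemma inner_product_combination:
  assumes x: "is_dual_basis l x" and I: "dual_inner_product I" and h: "linear h" and "k \<le> l"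
  shows "I (\<lambda>v. \<Sum>i<k. c i * x i v) h = (\<Sum>i<k. c i * I (x i) h)"
  using \<open>k \<le> l\<close>
proof (induction k)
  case 0
  \<comment> \<open>The empty combination is written as 0 times the linear form \<open>h\<close>, so
    that homogeneity gives its value.\<close>
  have "I (\<lambda>v. 0 * h v) h = 0 * I h h"
    using I h unfolding dual_inner_product_def by blast
  then show ?case by simp
next
  case (Suc k)
  have xk: "linear (x k)"
    using x Suc.prems by (simp add: is_dual_basis_def)
  then have ck: "linear (\<lambda>v. c k * x k v)"
    using linear_compose_scale_right[of "x k" "c k"] by simp
  have lin: "linear (\<lambda>v. \<Sum>i<k. c i * x i v)"
    using linear_combination_basis[OF x] Suc.prems by simp
  have "I (\<lambda>v. (\<Sum>i<k. c i * x i v) + c k * x k v) h = I (\<lambda>v. \<Sum>i<k. c i * x i v) h + I (\<lambda>v. c k * x k v) h"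
    using I lin ck h unfolding dual_inner_product_def by blast
  also have "I (\<lambda>v. c k * x k v) h = c k * I (x k) h"
    using I xk h unfolding dual_inner_product_def by blast
  finally show ?case
    using Suc by simp
qed

text \<open>A kernel vector of the Gram matrix gives a form orthogonal to the basis, hence to
  itself, so definiteness makes it 0. Both one-sided identities are recorded because
  \<open>form_to_der\<close> is inverted on either side.\<close>

lemma gram_inverse:
  assumes x: "is_dual_basis l x" and I: "dual_inner_product I"
  obtains B :: "nat \<Rightarrow> nat \<Rightarrow> real" where
    "\<And>i j. i < l \<Longrightarrow> j < l \<Longrightarrow> (\<Sum>k<l. B i k * I (x k) (x j)) = (if i = j then 1 else 0)"
    "\<And>i j. i < l \<Longrightarrow> j < l \<Longrightarrow> (\<Sum>k<l. I (x i) (x k) * B k j) = (if i = j then 1 else 0)"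
proof -
  define G where "G = mat l l (\<lambda>(i, j). I (x i) (x j))"
  have G: "G \<in> carrier_mat l l"
    by (simp add: G_def)
  have lin: "linear (x i)" if "i < l" for i
    using x that by (simp add: is_dual_basis_def)
  have "det G \<noteq> 0"
  proof
    assume "det G = 0"
    then obtain v where v: "v \<in> carrier_vec l" "v \<noteq> 0\<^sub>v l" "G *\<^sub>v v = 0\<^sub>v l"
      using det_0_iff_vec_prod_zero_field[OF G] by auto
    \<comment> \<open>Vanishing from \<open>l\<close> on is the normalisation that makes coordinates
      unique; it lets \<open>f = 0\<close> yield \<open>c = 0\<close> below.\<close>
    define c where "c i = (if i < l then v $ i else 0)" for i
    define f where "f = (\<lambda>w. \<Sum>i<l. c i * x i w)"
    have f: "linear f"
      unfolding f_def by (rule linear_combination_basis[OF x]) simp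
    have "I f (x j) = 0" if "j < l" for j
    proof -
      have "0 = (G *\<^sub>v v) $ j"
        using v that by simp
      also have "\<dots> = (\<Sum>i<l. I (x j) (x i) * c i)"
        using v(1) that G by (simp add: G_def scalar_prod_def c_def lessThan_atLeast0)
      also have "\<dots> = (\<Sum>i<l. c i * I (x i) (x j))"
        using I lin that by (auto simp: dual_inner_product_def intro!: sum.cong)
      also have "\<dots> = I f (x j)"
        unfolding f_def by (simp add: inner_product_combination[OF x I] lin that)
      finally show ?thesis ..
    qed
    moreover have "I (x j) f = I f (x j)" if "j < l" for j
      using I f lin[OF that] by (simp add: dual_inner_product_def)
    moreover have "I f f = (\<Sum>i<l. c i * I (x i) f)"
      using inner_product_combination[OF x I f, of l c] by (simp add: f_def)
    ultimately have "I f f = 0"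
      by simp
    then have "f = (\<lambda>v. 0)"
      using I f unfolding dual_inner_product_def by (metis less_irrefl)
    then have "dual_coord l x f = (\<lambda>i. 0)"
      using f by (intro dual_coord_unique[OF x]) auto
    moreover have "dual_coord l x f = c"
      by (rule dual_coord_unique[OF x f]) (auto simp: c_def f_def)
    ultimately have "v = 0\<^sub>v l"
      using v(1) by (auto simp: c_def fun_eq_iff intro!: eq_vecI) metis
    with v show False by simp
  qed
  from det_non_zero_imp_unit[OF G this] obtain B where B: "B \<in> carrier_mat l l" "B * G = 1\<^sub>m l" "G * B = 1\<^sub>m l"
    unfolding Units_def ring_mat_def by auto
  show thesis
  proof (rule that[of "\<lambda>i j. B $$ (i, j)"])
    fix i j
    assume "i < l" "j < l"
    then have "(B * G) $$ (i, j) = (if i = j then 1 else 0)" "(G * B) $$ (i, j) = (if i = j then 1 else 0)"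
      using B by auto
    then show "(\<Sum>k<l. B $$ (i, k) * I (x k) (x j)) = (if i = j then 1 else 0)"
      "(\<Sum>k<l. I (x i) (x k) * B $$ (k, j)) = (if i = j then 1 else 0)"
      using \<open>i < l\<close> \<open>j < l\<close> B(1) by (simp_all add: scalar_prod_def G_def lessThan_atLeast0)
  qed
qed

section \<open>The logarithmic module as a dual lattice\<close>

abbreviation const_fract :: "complex \<Rightarrow> cpoly fract"
  where "const_fract c \<equiv> to_fract (Poly_Mapping.single 0 c)"

lemma const_fract_mult: "const_fract c * const_fract d = const_fract (c * d)"
  by (simp add: mult_single flip: to_fract_mult)

lemma const_fract_sum: "(\<Sum>i\<in>A. const_fract (f i)) = const_fract (\<Sum>i\<in>A. f i)"
  by (induction A rule: infinite_finite_induct) (simp_all add: single_add)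

lemma partial_deriv_zero [simp]: "partial_deriv k 0 = 0"
  by (simp add: partial_deriv_def)

lemma partial_deriv_add: "partial_deriv k (p + q) = partial_deriv k p + partial_deriv k q"
  unfolding partial_deriv_def
  by (rule setsum_keys_plus_distrib) (simp_all add: single_add distrib_left)

lemma partial_deriv_sum: "partial_deriv k (\<Sum>i\<in>A. f i) = (\<Sum>i\<in>A. partial_deriv k (f i))"
  by (induction A rule: infinite_finite_induct) (simp_all add: partial_deriv_add)

lemma partial_deriv_var:
  "partial_deriv k (Poly_Mapping.single (Poly_Mapping.single i 1) c) = (if i = k then Poly_Mapping.single 0 c else 0)"
  by (simp add: partial_deriv_def lookup_single when_def)

lemma partial_deriv_lin_poly: "k < l \<Longrightarrow> partial_deriv k (lin_poly l c) = Poly_Mapping.single 0 (c k)"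
  unfolding lin_poly_def partial_deriv_sum partial_deriv_var by simp

lemma differential_lin_poly:
  "differential l (lin_poly l c) = (\<lambda>i. if i < l then const_fract (c i) else 0)"
  by (auto simp: differential_def partial_deriv_lin_poly)

lemma form_poly_eq_lin_poly:
  "form_poly l x f = lin_poly l (\<lambda>i. complex_of_real (dual_coord l x f i))"
  by (simp add: form_poly_def lin_poly_def)

text \<open>The coordinates of \<open>x k\<close> form the \<open>k\<close>-th unit vector, so
  passing from forms to derivations is multiplication by the Gram matrix.\<close>

lemma form_to_der_eq:
  assumes "is_dual_basis l x" "k < l"
  shows "form_to_der l x I \<omega> k = (\<Sum>i<l. \<omega> i * const_fract (complex_of_real (I (x i) (x k))))"
proof -
  have "form_to_der l x I \<omega> k = (\<Sum>i<l. \<Sum>j<l.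
      if j = k then \<omega> i * const_fract (complex_of_real (I (x i) (x k))) else 0)"
    unfolding form_to_der_def form_pairing_def form_poly_eq_lin_poly differential_lin_poly if_P[OF assms(2)]
    by (intro sum.cong refl) (simp add: dual_coord_basis[OF assms])
  then show ?thesis
    using assms by simp
qed

text \<open>The matrix identity (u M) N = u, entry by entry; it serves for the Gram matrix and its
  inverse in both orders.\<close>

lemma sum_inverse_matrices:
  fixes M N :: "nat \<Rightarrow> nat \<Rightarrow> 'a :: comm_ring_1"
  assumes "\<And>i. i < l \<Longrightarrow> (\<Sum>k<l. M i k * N k j) = (if i = j then 1 else 0)" "j < l"
  shows "(\<Sum>k<l. (\<Sum>i<l. u i * M i k) * N k j) = u j"
proof -
  have "(\<Sum>k<l. (\<Sum>i<l. u i * M i k) * N k j) = (\<Sum>i<l. u i * (\<Sum>k<l. M i k * N k j))"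
    unfolding sum_distrib_left sum_distrib_right by (subst sum.swap) (simp add: mult.assoc)
  also have "\<dots> = (\<Sum>i<l. if i = j then u j else 0)"
    by (rule sum.cong) (auto simp: assms)
  finally show ?thesis
    using assms by simp
qed

text \<open>\<open>B\<close> is the inverse Gram matrix. Definiteness of the inner product went into
  its existence; what is carried along are the two matrix identities.\<close>

locale euclidean_arrangement =
  fixes l :: nat
    and x :: "nat \<Rightarrow> 'v::real_vector \<Rightarrow> real"
    and I :: "('v \<Rightarrow> real) \<Rightarrow> ('v \<Rightarrow> real) \<Rightarrow> real"
    and B :: "nat \<Rightarrow> nat \<Rightarrow> real"
    and \<A> :: "'v set set"
    and \<alpha> :: "'v set \<Rightarrow> 'v \<Rightarrow> real"
  assumes basis: "is_dual_basis l x"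
    and gram_left: "i < l \<Longrightarrow> j < l \<Longrightarrow> (\<Sum>k<l. B i k * I (x k) (x j)) = (if i = j then 1 else 0)"
    and gram_right: "i < l \<Longrightarrow> j < l \<Longrightarrow> (\<Sum>k<l. I (x i) (x k) * B k j) = (if i = j then 1 else 0)"
    and arrangement: "central_arrangement \<A>"
    and forms: "defining_forms \<A> \<alpha>"
begin

definition der_to_form :: "(nat \<Rightarrow> cpoly fract) \<Rightarrow> nat \<Rightarrow> cpoly fract"
  where "der_to_form v = (\<lambda>j. if j < l then \<Sum>k<l. v k * const_fract (complex_of_real (B k j)) else 0)"

lemma der_to_form_form_to_der:
  assumes "\<And>i. i \<ge> l \<Longrightarrow> \<omega> i = 0"
  shows "der_to_form (form_to_der l x I \<omega>) = \<omega>"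
proof
  fix j
  have "(\<Sum>k<l. (\<Sum>i<l. \<omega> i * const_fract (complex_of_real (I (x i) (x k)))) * const_fract (complex_of_real (B k j))) = \<omega> j"
    if "j < l"
  proof (rule sum_inverse_matrices)
    fix i
    assume "i < l"
    then show "(\<Sum>k<l. const_fract (complex_of_real (I (x i) (x k))) * const_fract (complex_of_real (B k j))) = (if i = j then 1 else 0)"
      using gram_right[OF _ that]
      by (simp add: const_fract_mult const_fract_sum flip: of_real_mult of_real_sum)
  qed (fact that)
  then show "der_to_form (form_to_der l x I \<omega>) j = \<omega> j"
    using assms by (simp add: der_to_form_def form_to_der_eq[OF basis])
qed

lemma form_to_der_der_to_form:
  assumes "\<And>i. i \<ge> l \<Longrightarrow> v i = 0"
  shows "form_to_der l x I (der_to_form v) = v"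
proof
  fix j
  have "(\<Sum>k<l. (\<Sum>i<l. v i * const_fract (complex_of_real (B i k))) * const_fract (complex_of_real (I (x k) (x j)))) = v j"
    if "j < l"
  proof (rule sum_inverse_matrices)
    fix i
    assume "i < l"
    then show "(\<Sum>k<l. const_fract (complex_of_real (B i k)) * const_fract (complex_of_real (I (x k) (x j)))) = (if i = j then 1 else 0)"
      using gram_left[OF _ that]
      by (simp add: const_fract_mult const_fract_sum flip: of_real_mult of_real_sum)
  qed (fact that)
  then show "form_to_der l x I (der_to_form v) j = v j"
    using assms by (cases "j < l") (simp_all add: der_to_form_def form_to_der_eq[OF basis], simp add: form_to_der_def)
qed

section \<open>Coprimality of the forms of distinct hyperplanes\<close>

definition form_coeff :: "'v set \<Rightarrow> nat \<Rightarrow> complex"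
  where "form_coeff H = (\<lambda>i. complex_of_real (dual_coord l x (\<alpha> H) i))"

abbreviation form :: "'v set \<Rightarrow> cpoly"
  where "form H \<equiv> form_poly l x (\<alpha> H)"

lemma form_eq: "form H = lin_poly l (form_coeff H)"
  by (simp add: form_poly_eq_lin_poly form_coeff_def)

lemma form_in_carrier [simp, intro]: "form H \<in> poly_carrier l"
  by (simp add: form_eq)

lemma form_expansion:
  assumes "H \<in> \<A>"
  shows "\<alpha> H = (\<lambda>v. \<Sum>i<l. dual_coord l x (\<alpha> H) i * x i v)"
  using assms forms by (intro dual_coord_eq[OF basis]) (simp add: defining_forms_def)

text \<open>A zero form would have the whole space as its kernel \<open>H\<close>, against the
  dimension of a hyperplane.\<close>

lemma arrangement_form_nonzero: "H \<in> \<A> \<Longrightarrow> \<exists>v. \<alpha> H v \<noteq> 0"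
proof (rule ccontr)
  assume H: "H \<in> \<A>" and "\<nexists>v. \<alpha> H v \<noteq> 0"
  then have "H = UNIV"
    using forms unfolding defining_forms_def by blast
  then show False
    using H arrangement by (auto simp: central_arrangement_def linear_hyperplane_def)
qed

lemma form_coeff_nonzero:
  assumes "H \<in> \<A>"
  obtains k where "k < l" "form_coeff H k \<noteq> 0"
proof -
  obtain v where "\<alpha> H v \<noteq> 0"
    using arrangement_form_nonzero[OF assms] by blast
  then have "(\<Sum>i<l. dual_coord l x (\<alpha> H) i * x i v) \<noteq> 0"
    using form_expansion[OF assms] by metis
  then have "\<exists>k\<in>{..<l}. dual_coord l x (\<alpha> H) k * x k v \<noteq> 0"
    by (meson sum.neutral)
  then obtain k where "k < l" "dual_coord l x (\<alpha> H) k \<noteq> 0"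
    by auto
  then show thesis
    using that by (simp add: form_coeff_def)
qed

lemma form_nonzero:
  assumes "H \<in> \<A>"
  shows "form H \<noteq> 0"
proof -
  obtain k where "k < l" "form_coeff H k \<noteq> 0"
    using form_coeff_nonzero[OF assms] by blast
  then show ?thesis
    using lookup_lin_poly[of k l "form_coeff H"] by (auto simp: form_eq)
qed

text \<open>Proportional forms have the same kernel, and the kernels are the hyperplanes
  themselves.\<close>

lemma form_not_divides_form:
  assumes H: "H \<in> \<A>" and H': "H' \<in> \<A>" and "H \<noteq> H'"
  shows "\<not> form H divides\<^bsub>poly_ring l\<^esub> form H'"
proof
  assume *: "form H divides\<^bsub>poly_ring l\<^esub> form H'"
  obtain k where k: "k < l" "form_coeff H k \<noteq> 0"
    using form_coeff_nonzero[OF H] by blast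
  \<comment> \<open>The ratio of the complex coefficients is real because the coordinates are, so
    the proportionality descends to functions on the real space.\<close>
  define t where "t = dual_coord l x (\<alpha> H') k / dual_coord l x (\<alpha> H) k"
  have "dual_coord l x (\<alpha> H') i = t * dual_coord l x (\<alpha> H) i" if "i < l" for i
  proof -
    have "form_coeff H' i = form_coeff H' k / form_coeff H k * form_coeff H i"
      using lin_poly_divides_lin_poly[of k l "form_coeff H" "form_coeff H'" i] k * that unfolding form_eq by blast
    then have "complex_of_real (dual_coord l x (\<alpha> H') i) = complex_of_real (t * dual_coord l x (\<alpha> H) i)"
      by (simp add: form_coeff_def t_def)
    then show ?thesis
      by (simp only: of_real_eq_iff)
  qed
  then have "(\<Sum>i<l. dual_coord l x (\<alpha> H') i * x i v) = t * (\<Sum>i<l. dual_coord l x (\<alpha> H) i * x i v)" for v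
    by (simp add: sum_distrib_left mult.assoc)
  then have eq: "\<alpha> H' v = t * \<alpha> H v" for v
    using form_expansion[OF H] form_expansion[OF H'] by metis
  then have "t \<noteq> 0"
    using arrangement_form_nonzero[OF H'] by auto
  then have "{v. \<alpha> H' v = 0} = {v. \<alpha> H v = 0}"
    using eq by simp
  then show False
    using forms H H' \<open>H \<noteq> H'\<close> by (simp add: defining_forms_def)
qed

lemma arr_Q_in_carrier [simp, intro]: "arr_Q l x \<alpha> \<B> n \<in> poly_carrier l"
  by (auto simp: arr_Q_def)

lemma finite_arrangement: "\<B> \<subseteq> \<A> \<Longrightarrow> finite \<B>"
  using arrangement finite_subset by (auto simp: central_arrangement_def)

lemma arr_Q_nonzero: "\<B> \<subseteq> \<A> \<Longrightarrow> arr_Q l x \<alpha> \<B> n \<noteq> 0"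
  using form_nonzero by (auto simp: arr_Q_def finite_arrangement)

lemma arr_Q_remove: "\<B> \<subseteq> \<A> \<Longrightarrow> H \<in> \<B> \<Longrightarrow> arr_Q l x \<alpha> \<B> n = form H ^ n H * arr_Q l x \<alpha> (\<B> - {H}) n"
  unfolding arr_Q_def by (rule prod.remove) (auto simp: finite_arrangement)

text \<open>A prime dividing the product divides some \<open>form H'\<close> with \<open>H'\<close>
  in \<open>\<B>\<close>, hence with \<open>H'\<close> different from \<open>H\<close>.\<close>

lemma form_not_divides_arr_Q:
  assumes "\<B> \<subseteq> \<A>" "H \<in> \<A>" "H \<notin> \<B>"
  shows "\<not> form H divides\<^bsub>poly_ring l\<^esub> arr_Q l x \<alpha> \<B> n"
proof
  assume *: "form H divides\<^bsub>poly_ring l\<^esub> arr_Q l x \<alpha> \<B> n"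
  obtain k where k: "k < l" "form_coeff H k \<noteq> 0"
    using form_coeff_nonzero assms by blast
  show False
  proof (rule lin_poly_divides_prod[of k l "form_coeff H" \<B> "\<lambda>H'. form H' ^ n H'"])
    show "lin_poly l (form_coeff H) divides\<^bsub>poly_ring l\<^esub> (\<Prod>H'\<in>\<B>. form H' ^ n H')"
      using * by (simp add: arr_Q_def form_eq[of H])
    fix H'
    assume H': "H' \<in> \<B>" "lin_poly l (form_coeff H) divides\<^bsub>poly_ring l\<^esub> form H' ^ n H'"
    have "form H divides\<^bsub>poly_ring l\<^esub> form H'"
      using lin_poly_divides_power[OF k(1), of "form_coeff H" "form H'" "n H'"] k H'
      by (simp add: form_eq[of H])
    then show False
      using form_not_divides_form assms H' by blast
  qed (use k in auto)
qed

text \<open>The regularity of \<open>d\<alpha>\<^sub>H \<and> \<omega>\<close> along \<open>H\<close> is a condition over the localization at \<open>\<alpha>\<^sub>H\<close>.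
  As its denominator divides \<open>Q\<close>, multiplication by the factor of \<open>Q\<close> prime to \<open>\<alpha>\<^sub>H\<close>
  turns it into a condition over \<open>S\<close>.\<close>

definition Omega_functional :: "('v set \<Rightarrow> nat) \<Rightarrow> 'v set set \<Rightarrow> 'v set \<Rightarrow> nat \<Rightarrow> nat \<Rightarrow> nat \<Rightarrow> cpoly fract"
  where "Omega_functional n \<B> H i j = (\<lambda>k. to_fract (arr_Q l x \<alpha> (\<B> - {H}) n) *
    (const_fract (form_coeff H i) * const_fract (complex_of_real (B k j)) -
     const_fract (form_coeff H j) * const_fract (complex_of_real (B k i))))"

text \<open>The first family says that \<open>v\<close> has denominator Q, the product over
  \<open>\<N>\<close>, and supplies the multiples of unit vectors that reflexivity asks for. With
  \<theta> = Q v, the second computes \<theta>(\<alpha>_H) divided by the required power of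
  \<alpha>_H. The third consists of the wedge conditions.\<close>

definition DOmega_functionals ::
    "'v set set \<Rightarrow> ('v set \<Rightarrow> nat) \<Rightarrow> 'v set set \<Rightarrow> ('v set \<Rightarrow> nat) \<Rightarrow> (nat \<Rightarrow> cpoly fract) set"
  where "DOmega_functionals \<P> p \<N> n =
    {\<lambda>j. if j = i then to_fract (arr_Q l x \<alpha> \<N> n) else 0 | i. i < l} \<union>
    {\<lambda>i. to_fract (arr_Q l x \<alpha> \<N> n) * const_fract (form_coeff H i) / to_fract (form H ^ p H) | H. H \<in> \<P>} \<union>
    {Omega_functional n \<N> H i j | H i j. H \<in> \<N> \<and> i < j \<and> j < l}"

lemma frac_dot_Omega_functional:
  assumes "i < l" "j < l"
  shows "frac_dot l (Omega_functional n \<B> H i j) v = to_fract (arr_Q l x \<alpha> (\<B> - {H}) n) *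
    wedge_coeff (differential l (form H)) (der_to_form v) i j"
proof -
  let ?s = "to_fract (arr_Q l x \<alpha> (\<B> - {H}) n)"
  let ?c = "\<lambda>i. const_fract (form_coeff H i)"
  let ?b = "\<lambda>k i. v k * const_fract (complex_of_real (B k i))"
  have "frac_dot l (Omega_functional n \<B> H i j) v = (\<Sum>k<l. ?s * (?c i * ?b k j) - ?s * (?c j * ?b k i))"
    unfolding frac_dot_def Omega_functional_def by (intro sum.cong refl) (simp only: algebra_simps)
  also have "\<dots> = ?s * (?c i * (\<Sum>k<l. ?b k j)) - ?s * (?c j * (\<Sum>k<l. ?b k i))"
    by (simp only: sum_subtractf sum_distrib_left)
  finally show ?thesis
    using assms by (simp only: wedge_coeff_def form_eq differential_lin_poly der_to_form_def if_True right_diff_distrib)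
qed

lemma der_apply_form:
  "to_fract (der_apply l \<theta> (form H)) = (\<Sum>i<l. to_fract (\<theta> i) * const_fract (form_coeff H i))"
  by (auto simp: der_apply_def form_eq partial_deriv_lin_poly intro!: sum.cong)

text \<open>The entries of \<open>B\<close> are constants, so the passage to forms keeps the
  denominator \<open>q\<close>; integrality of Q v thus also places the associated form in the
  module of forms with denominator Q.\<close>

lemma der_to_form_quotient:
  assumes "\<theta> \<in> poly_vecs l"
  obtains \<eta> where "\<eta> \<in> poly_vecs l"
    "der_to_form (\<lambda>i. to_fract (\<theta> i) / to_fract q) = (\<lambda>i. to_fract (\<eta> i) / to_fract q)"
proof (rule that)
  let ?\<eta> = "\<lambda>j. if j < l then \<Sum>k<l. \<theta> k * Poly_Mapping.single 0 (complex_of_real (B k j)) else 0"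
  show "?\<eta> \<in> poly_vecs l"
    using assms by (auto simp: poly_vecs_def)
  show "der_to_form (\<lambda>i. to_fract (\<theta> i) / to_fract q) = (\<lambda>i. to_fract (?\<eta> i) / to_fract q)"
    by (auto simp: der_to_form_def sum_divide_distrib)
qed

lemma DOmega_subset_dual_lattice:
  assumes P: "\<P> \<subseteq> \<A>" and N: "\<N> \<subseteq> \<A>"
    and \<theta>: "\<theta> \<in> log_der l x \<alpha> \<P> p" and \<omega>: "\<omega> \<in> log_forms l x \<alpha> \<N> n"
    and v\<theta>: "v = (\<lambda>i. to_fract (\<theta> i) / to_fract (arr_Q l x \<alpha> \<N> n))" and v\<omega>: "v = form_to_der l x I \<omega>"
  shows "v \<in> dual_lattice l (DOmega_functionals \<P> p \<N> n)"
  unfolding dual_lattice_def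
proof (intro CollectI conjI ballI)
  let ?Q = "arr_Q l x \<alpha> \<N> n"
  have Q: "?Q \<noteq> 0"
    using arr_Q_nonzero[OF N] .
  show "v \<in> frac_vecs l"
    using \<theta> Q unfolding v\<theta> by (auto simp: log_der_def poly_vecs_def frac_vecs_def intro!: frac_carrierI)
  obtain \<eta> where \<eta>: "\<eta> \<in> poly_vecs l" "\<omega> = (\<lambda>i. to_fract (\<eta> i) / to_fract ?Q)"
    using \<omega> by (auto simp: log_forms_def)
  \<comment> \<open>This recovers \<omega> from \<open>v\<close>, so its wedge conditions become
    conditions on \<open>v\<close>.\<close>
  have v_form: "der_to_form v = \<omega>"
    unfolding v\<omega> using \<eta> by (intro der_to_form_form_to_der) (auto simp: poly_vecs_def)
  fix c
  assume "c \<in> DOmega_functionals \<P> p \<N> n"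
  then consider (coord) i where "i < l" "c = (\<lambda>j. if j = i then to_fract ?Q else 0)"
    | (der) H where "H \<in> \<P>" "c = (\<lambda>i. to_fract ?Q * const_fract (form_coeff H i) / to_fract (form H ^ p H))"
    | (wedge) H i j where "H \<in> \<N>" "i < j" "j < l" "c = Omega_functional n \<N> H i j"
    unfolding DOmega_functionals_def by blast
  then show "frac_dot l c v \<in> poly_fracts l"
  proof cases
    case coord
    then show ?thesis
      using \<theta> Q by (simp add: frac_dot_unit v\<theta> log_der_def poly_vecs_def)
  next
    case der
    then obtain s where s: "s \<in> poly_carrier l" "der_apply l \<theta> (form H) = s * form H ^ p H"
      using \<theta> by (auto simp: log_der_def)
    have "frac_dot l c v = to_fract (der_apply l \<theta> (form H)) / to_fract (form H ^ p H)"
      unfolding der_apply_form sum_divide_distrib frac_dot_def der v\<theta> using Q by (intro sum.cong) auto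
    also have "\<dots> = to_fract s"
      using s form_nonzero der P by auto
    finally show ?thesis
      using s by simp
  next
    case wedge
    let ?s = "arr_Q l x \<alpha> (\<N> - {H}) n"
    let ?w = "wedge_coeff (differential l (form H)) \<omega> i j"
    have H: "H \<in> \<A>"
      using wedge N by blast
    obtain k where k: "k < l" "form_coeff H k \<noteq> 0"
      using form_coeff_nonzero[OF H] by blast
    have s: "?s \<noteq> 0"
      using arr_Q_nonzero[of "\<N> - {H}" n] N by blast
    have Q_eq: "?Q = form H ^ n H * ?s"
      using arr_Q_remove[OF N] wedge by simp
    let ?g = "Poly_Mapping.single 0 (form_coeff H i) * \<eta> j - Poly_Mapping.single 0 (form_coeff H j) * \<eta> i"
    have g: "?g \<in> poly_carrier l"
      using \<eta> wedge less_trans[of i j l]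
      by (intro poly_carrier_diff poly_carrier_mult) (auto simp: poly_vecs_def)
    have w: "?w = to_fract ?g / to_fract ?Q"
      using wedge by (simp add: wedge_coeff_def form_eq differential_lin_poly \<eta> diff_divide_distrib)
    obtain r q where rq: "r \<in> poly_carrier l" "q \<in> poly_carrier l"
      "\<not> form H divides\<^bsub>poly_ring l\<^esub> q" "?w = to_fract r / to_fract q"
      using \<omega> wedge unfolding log_forms_def regular_along_def Fract_conv_to_fract by blast
    have "q \<noteq> 0"
      using rq by (auto simp: divides_poly_ring)
    \<comment> \<open>The coefficient is written once over Q and once over a denominator prime to
      the form. Cross-multiplying shows that the power \<open>n H\<close> of the form divides
      \<open>?g * q\<close>, hence \<open>?g\<close>; only \<open>?s\<close> is left in the
      denominator, and the functional clears it.\<close>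
    then have "to_fract ?g * to_fract q = to_fract r * to_fract ?Q"
      using frac_eq_eq[of "to_fract ?Q" "to_fract q" "to_fract ?g" "to_fract r"] w rq Q
      by (simp only: to_fract_eq_0_iff not_False_eq_True simp_thms)
    then have "to_fract (?g * q) = to_fract (?Q * r)"
      by (simp only: to_fract_mult mult.commute)
    then have "?g * q = form H ^ n H * (?s * r)"
      unfolding to_fract_eq_iff Q_eq by (simp add: mult.assoc)
    then have "lin_poly l (form_coeff H) ^ n H divides\<^bsub>poly_ring l\<^esub> ?g * q"
      using rq by (auto simp: divides_poly_ring form_eq[of H] intro!: bexI[of _ "?s * r"])
    then have "form H ^ n H divides\<^bsub>poly_ring l\<^esub> ?g"
      using power_lin_poly_divides_mult[of k l "form_coeff H" ?g q "n H"] k g rq(2,3) unfolding form_eq[of H] by blast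
    then obtain t where t: "t \<in> poly_carrier l" "?g = form H ^ n H * t"
      by (auto simp: divides_poly_ring)
    have "frac_dot l c v = to_fract ?s * (to_fract (form H ^ n H * t) / to_fract (form H ^ n H * ?s))"
      using wedge by (simp only: frac_dot_Omega_functional v_form w t Q_eq less_trans[of i j l])
    also have "\<dots> = to_fract t"
      using s form_nonzero[OF H] by simp
    finally show ?thesis
      using t by simp
  qed
qed

lemma dual_lattice_subset_DOmega:
  assumes P: "\<P> \<subseteq> \<A>" and N: "\<N> \<subseteq> \<A>" and v: "v \<in> dual_lattice l (DOmega_functionals \<P> p \<N> n)"
  shows "v \<in> (\<lambda>\<theta> i. to_fract (\<theta> i) / to_fract (arr_Q l x \<alpha> \<N> n)) ` log_der l x \<alpha> \<P> p"
    and "v \<in> form_to_der l x I ` log_forms l x \<alpha> \<N> n"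
proof -
  let ?Q = "arr_Q l x \<alpha> \<N> n"
  have Q: "?Q \<noteq> 0"
    using arr_Q_nonzero[OF N] .
  have dot: "frac_dot l c v \<in> poly_fracts l" if "c \<in> DOmega_functionals \<P> p \<N> n" for c
    using v that by (simp add: dual_lattice_def)
  have v_out: "v i = 0" if "i \<ge> l" for i
    using v that by (simp add: dual_lattice_def frac_vecs_def)
  have Qv: "to_fract ?Q * v i \<in> poly_fracts l" if "i < l" for i
  proof -
    have "(\<lambda>j. if j = i then to_fract ?Q else 0) \<in> DOmega_functionals \<P> p \<N> n"
      unfolding DOmega_functionals_def using that by blast
    from dot[OF this] show ?thesis
      using that by (simp add: frac_dot_unit)
  qed
  define \<theta> where "\<theta> i = poly_of (to_fract ?Q * v i)" for i
  have \<theta>: "to_fract (\<theta> i) = to_fract ?Q * v i" for i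
    using to_fract_poly_of[OF Qv, of i] to_fract_poly_of[OF poly_fracts_zero] v_out[of i]
    by (cases "i < l") (simp_all add: \<theta>_def)
  then have v_eq: "v = (\<lambda>i. to_fract (\<theta> i) / to_fract ?Q)"
    using Q by simp
  have "\<theta> i = 0" if "i \<ge> l" for i
    using \<theta>[of i] v_out[OF that] by simp
  then have \<theta>_vec: "\<theta> \<in> poly_vecs l"
    using Qv by (auto simp: poly_vecs_def \<theta>_def)
  have "\<exists>s\<in>poly_carrier l. der_apply l \<theta> (form H) = s * form H ^ p H" if H: "H \<in> \<P>" for H
  proof -
    let ?c = "\<lambda>i. to_fract ?Q * const_fract (form_coeff H i) / to_fract (form H ^ p H)"
    have "?c \<in> DOmega_functionals \<P> p \<N> n"
      unfolding DOmega_functionals_def using H by blast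
    from dot[OF this] obtain s where s: "s \<in> poly_carrier l" "frac_dot l ?c v = to_fract s"
      by (auto simp: poly_fracts_def)
    have "to_fract (der_apply l \<theta> (form H)) = frac_dot l ?c v * to_fract (form H ^ p H)"
      unfolding der_apply_form \<theta> frac_dot_def sum_distrib_right
      using form_nonzero H P by (intro sum.cong) auto
    then have "der_apply l \<theta> (form H) = s * form H ^ p H"
      unfolding s(2) by (simp only: to_fract_eq_iff flip: to_fract_mult)
    then show ?thesis
      using s by blast
  qed
  then have "\<theta> \<in> log_der l x \<alpha> \<P> p"
    using \<theta>_vec by (simp add: log_der_def)
  then show "v \<in> (\<lambda>\<theta> i. to_fract (\<theta> i) / to_fract ?Q) ` log_der l x \<alpha> \<P> p"
    using v_eq by blast
  obtain \<eta> where \<eta>: "\<eta> \<in> poly_vecs l" "der_to_form v = (\<lambda>i. to_fract (\<eta> i) / to_fract ?Q)"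
    using der_to_form_quotient[OF \<theta>_vec, of ?Q] v_eq by metis
  have "regular_along l (form H) (wedge_coeff (differential l (form H)) (der_to_form v) i j)"
    if H: "H \<in> \<N>" and ij: "i < j" "j < l" for H i j
  proof -
    let ?s = "arr_Q l x \<alpha> (\<N> - {H}) n"
    let ?w = "wedge_coeff (differential l (form H)) (der_to_form v) i j"
    have "Omega_functional n \<N> H i j \<in> DOmega_functionals \<P> p \<N> n"
      unfolding DOmega_functionals_def using H ij by blast
    from dot[OF this] obtain t where t: "t \<in> poly_carrier l" "to_fract ?s * ?w = to_fract t"
      using ij by (auto simp: frac_dot_Omega_functional poly_fracts_def)
    have "?s \<noteq> 0"
      using arr_Q_nonzero[of "\<N> - {H}" n] N by blast
    \<comment> \<open>\<open>?s\<close> itself serves as the denominator in the regularity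
      condition: all its factors belong to other hyperplanes.\<close>
    then have "?w = Fract t ?s"
      using t by (simp add: Fract_conv_to_fract field_simps)
    moreover have "\<not> form H divides\<^bsub>poly_ring l\<^esub> ?s"
      using N H by (intro form_not_divides_arr_Q) auto
    ultimately show ?thesis
      unfolding regular_along_def using t by blast
  qed
  then have "der_to_form v \<in> log_forms l x \<alpha> \<N> n"
    unfolding log_forms_def using \<eta> by blast
  then show "v \<in> form_to_der l x I ` log_forms l x \<alpha> \<N> n"
    using form_to_der_der_to_form[of v] v_out by (metis image_eqI)
qed

lemma DOmega_eq_dual_lattice:
  "DOmega l x I \<alpha> \<A> m = dual_lattice l (DOmega_functionals
    (pos_part \<A> m) (\<lambda>H. nat (mult_restrict (pos_part \<A> m) m H))
    (neg_part \<A> m) (\<lambda>H. nat (- mult_restrict (neg_part \<A> m) m H)))"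
proof -
  let ?p = "\<lambda>H. nat (mult_restrict (pos_part \<A> m) m H)"
  let ?n = "\<lambda>H. nat (- mult_restrict (neg_part \<A> m) m H)"
  have subset: "pos_part \<A> m \<subseteq> \<A>" "neg_part \<A> m \<subseteq> \<A>"
    by (auto simp: pos_part_def neg_part_def)
  show ?thesis
    unfolding DOmega_def Let_def
  proof (rule equalityI)
    show "(\<lambda>\<theta> i. to_fract (\<theta> i) / to_fract (arr_Q l x \<alpha> (neg_part \<A> m) ?n)) `
        log_der l x \<alpha> (pos_part \<A> m) ?p \<inter> form_to_der l x I ` log_forms l x \<alpha> (neg_part \<A> m) ?n
      \<subseteq> dual_lattice l (DOmega_functionals (pos_part \<A> m) ?p (neg_part \<A> m) ?n)"
      by (rule subsetI, elim IntE imageE, rule DOmega_subset_dual_lattice[OF subset])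
    show "dual_lattice l (DOmega_functionals (pos_part \<A> m) ?p (neg_part \<A> m) ?n) \<subseteq>
      (\<lambda>\<theta> i. to_fract (\<theta> i) / to_fract (arr_Q l x \<alpha> (neg_part \<A> m) ?n)) `
        log_der l x \<alpha> (pos_part \<A> m) ?p \<inter> form_to_der l x I ` log_forms l x \<alpha> (neg_part \<A> m) ?n"
    proof (rule subsetI, rule IntI)
      fix v
      assume "v \<in> dual_lattice l (DOmega_functionals (pos_part \<A> m) ?p (neg_part \<A> m) ?n)"
      note * = dual_lattice_subset_DOmega[OF subset this]
      show "v \<in> (\<lambda>\<theta> i. to_fract (\<theta> i) / to_fract (arr_Q l x \<alpha> (neg_part \<A> m) ?n)) `
          log_der l x \<alpha> (pos_part \<A> m) ?p"
        by (rule *(1))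
      show "v \<in> form_to_der l x I ` log_forms l x \<alpha> (neg_part \<A> m) ?n"
        by (rule *(2))
    qed
  qed
qed

lemma dual_lattice_DOmega_functionals_reflexive:
  assumes P: "\<P> \<subseteq> \<A>" and N: "\<N> \<subseteq> \<A>"
  shows "reflexive_module (poly_ring l) (submodule_of_fracs l (dual_lattice l (DOmega_functionals \<P> p \<N> n)))"
proof (rule dual_lattice_reflexive)
  \<comment> \<open>\<open>?Q\<close> scales the unit vectors inside the set of functionals, and
    \<open>?R\<close> is a common denominator: only the second family has denominators, each
    dividing \<open>?R\<close>, while the wedge family is polynomial because \<open>B\<close> is
    constant.\<close>
  let ?Q = "arr_Q l x \<alpha> \<N> n"
  let ?R = "arr_Q l x \<alpha> \<P> p"
  show "?Q \<in> poly_carrier l" "?R \<in> poly_carrier l"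
    by auto
  show "?Q \<noteq> 0" "?R \<noteq> 0"
    using arr_Q_nonzero assms by auto
  show "(\<lambda>j. if j = i then to_fract ?Q else 0) \<in> DOmega_functionals \<P> p \<N> n" if "i < l" for i
    unfolding DOmega_functionals_def using that by blast
  fix c k
  assume "c \<in> DOmega_functionals \<P> p \<N> n" "k < l"
  then consider (coord) i where "i < l" "c = (\<lambda>j. if j = i then to_fract ?Q else 0)"
    | (der) H where "H \<in> \<P>" "c = (\<lambda>i. to_fract ?Q * const_fract (form_coeff H i) / to_fract (form H ^ p H))"
    | (wedge) H i j where "H \<in> \<N>" "i < j" "j < l" "c = Omega_functional n \<N> H i j"
    unfolding DOmega_functionals_def by blast
  then show "to_fract ?R * c k \<in> poly_fracts l"
  proof cases
    case coord
    then show ?thesis by auto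
  next
    case der
    have "to_fract ?R * c k = to_fract (arr_Q l x \<alpha> (\<P> - {H}) p * ?Q * Poly_Mapping.single 0 (form_coeff H k))"
      using form_nonzero der P by (auto simp: arr_Q_remove[OF P der(1)])
    then show ?thesis
      by (auto simp del: to_fract_mult)
  next
    case wedge
    then show ?thesis
      by (auto simp: Omega_functional_def intro!: poly_fracts_mult poly_fracts_diff)
  qed
qed

end

theorem corollary1p8:
  fixes l :: nat
    and x :: "nat \<Rightarrow> 'v::real_vector \<Rightarrow> real"
    and I :: "('v \<Rightarrow> real) \<Rightarrow> ('v \<Rightarrow> real) \<Rightarrow> real"
    and \<A> :: "'v set set"
    and \<alpha> :: "'v set \<Rightarrow> 'v \<Rightarrow> real"
    and m :: "'v set \<Rightarrow> int"
  assumes "is_dual_basis l x"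
    and "dual_inner_product I"
    and "central_arrangement \<A>"
    and "defining_forms \<A> \<alpha>"
  shows "reflexive_module (poly_ring l) (DOmega_module l x I \<alpha> \<A> m)"
proof -
  obtain B :: "nat \<Rightarrow> nat \<Rightarrow> real" where B:
    "\<And>i j. i < l \<Longrightarrow> j < l \<Longrightarrow> (\<Sum>k<l. B i k * I (x k) (x j)) = (if i = j then 1 else 0)"
    "\<And>i j. i < l \<Longrightarrow> j < l \<Longrightarrow> (\<Sum>k<l. I (x i) (x k) * B k j) = (if i = j then 1 else 0)"
    using gram_inverse[OF assms(1,2)] by blast
  interpret euclidean_arrangement l x I B \<A> \<alpha>
    by unfold_locales (use assms B in auto)
  show ?thesis
    unfolding DOmega_module_def DOmega_eq_dual_lattice
    by (rule dual_lattice_DOmega_functionals_reflexive) (auto simp: pos_part_def neg_part_def)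
qed

end
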